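(* In the setting below, the kernel of the linear map \[\partial_3:\{\text{solutions of }H_A(A\cdot v)\}\longrightarrow\{\text{solutions of }H_A(\beta)\},\qquad \psi\mapsto\partial\psi/\partial x_3,\] is spanned by $\{x^u: u \text{ is a fake exponent of } H_A(A\cdot v) \text{ (with respect to } w') \text{ with minimum negative support and } u_3=0\}$.
   Context: Setting: $A=(a_{ij})$ is a $d\times n$ integer matrix of rank $d$, $n-d=2$, columns in $\{1\}\times\mathbb{Z}^{d-1}$ spanning $\mathbb{Z}^d$; $I_A\subset\mathbb{C}[\partial_1,\dots,\partial_n]$ is generated by $\partial^u-\partial^{u'}$, $u,u'\in\mathbb{N}^n$, $Au=Au'$; $H_A(\beta')$ is the left ideal of the Weyl algebra generated by $I_A$ and $\sum_j a_{ij}x_j\partial_j-\beta'_i$; its solutions are (possibly logarithmic) holomorphic solutions on a common open set near a generic point. $B=(b_{ji})$ is $n\times2$ with columns $B_1,B_2$ a $\mathbb{Z}$-basis of $\ker_{\mathbb{Z}}(A)$, $b_{11},b_{12}>0$, $b_{21}<0<b_{22}$, $b_{31},b_{32}<0$, $b_{41}>0>b_{42}$, and if rows 2, 4 of $B$ are linearly independent then $\{z\in\mathbb{R}^2:(Bz)_2\ge0,(Bz)_4\ge0\}$ lies in the first quadrant. $\alpha_5,\dots,\alpha_n\in\mathbb{C}\setminus\mathbb{Q}$ with $\alpha_i\notin\mathbb{Q}(\alpha_j:j\ge5,j\ne i)$; $v=B_{1+}+B_{2+}-e_1-e_2-e_4+\sum_{i\ge5}\alpha_ie_i$, where $(u_+)_l=\max(u_l,0)$;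 $\beta=A(v-e_3)$. Weight: $w'=-e_3$ if $\operatorname{in}_{-e_3}(I_A)$ is a monomial ideal; otherwise $w'=-e_3+\epsilon w$ with $w\in\mathbb{R}^n$ and $\epsilon>0$ small such that $\operatorname{in}_{w'}(I_A)=\operatorname{in}_w(\operatorname{in}_{-e_3}(I_A))$ is monomial. A standard pair of a monomial ideal $M$ is a pair $(\partial^\eta,\sigma)$ with $\eta_i=0$ for $i\in\sigma$, $\partial^\eta\prod_{i\in\sigma}\partial_i^{\mu_i}\notin M$ for all $\mu$, and for each $l\notin\sigma$ some $\partial^\eta\partial_l^{\mu_l}\prod_{i\in\sigma}\partial_i^{\mu_i}\in M$. A fake exponent of $H_A(\beta')$ with respect to $w'$ is $u\in\mathbb{C}^n$ with $Au=\beta'$ and $u_i=\eta_i$ ($i\notin\sigma$) for a standard pair $(\partial^\eta,\sigma)$ of $\operatorname{in}_{w'}(I_A)$. $\operatorname{nsupp}(u)=\{i:u_i\in\mathbb{Z}_{<0}\}$; $u$ has minimum negative support if for every $v'\in\ker_{\mathbb{Z}}(A)$, $\operatorname{nsupp}(u+v')\subseteq\operatorname{nsupp}(u)$ implies equality. $x^u=\prod_i\exp(u_i\log x_i)$. *)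

theory Defs
  imports
    "HOL-Analysis.Analysis"
    "HOL-Library.Poly_Mapping"
    "HOL-Library.Function_Algebras"
begin

text \<open>
  Coordinates are indexed by finite types: \<open>'n\<close> for the columns of \<open>A\<close> (the variables)
  and \<open>'d\<close> for its rows. Multi-exponents are vectors in \<open>nat ^ 'n\<close>.
\<close>

subsection \<open>Commutative polynomials in the partial derivatives\<close>

type_synonym 'n dpoly = "(nat ^ 'n) \<Rightarrow>\<^sub>0 complex"

definition dmonom :: "nat ^ 'n \<Rightarrow> 'n::finite dpoly" where
  "dmonom u = Poly_Mapping.single u 1"

definition ideal_gen :: "'a::comm_ring_1 set \<Rightarrow> 'a set" where
  "ideal_gen S = module.span (*) S"

lemma module_ring_mult: "module ((*) :: 'a::comm_ring_1 \<Rightarrow> 'a \<Rightarrow> 'a)"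
  by unfold_locales (simp_all add: algebra_simps)

definition toric_ideal :: "int ^ 'n ^ 'd \<Rightarrow> 'n::finite dpoly set" where
  "toric_ideal A = ideal_gen {dmonom u - dmonom u' | u u'.
     A *v (\<chi> j. int (u $ j)) = A *v (\<chi> j. int (u' $ j))}"

definition wt :: "real ^ 'n \<Rightarrow> nat ^ 'n \<Rightarrow> real" where
  "wt w u = (\<Sum>j\<in>UNIV. w $ j * real (u $ j))"

text \<open>Initial forms collect the terms of \<^emph>\<open>maximal\<close> weight.\<close>

definition initial_form :: "real ^ 'n \<Rightarrow> 'n::finite dpoly \<Rightarrow> 'n dpoly" where
  "initial_form w f =
     (\<Sum>u \<in> {u \<in> Poly_Mapping.keys f. \<forall>u' \<in> Poly_Mapping.keys f. wt w u' \<le> wt w u}.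
        Poly_Mapping.single u (Poly_Mapping.lookup f u))"

definition initial_ideal :: "real ^ 'n \<Rightarrow> 'n::finite dpoly set \<Rightarrow> 'n dpoly set" where
  "initial_ideal w I = ideal_gen (initial_form w ` I)"

definition monomial_ideal :: "'n::finite dpoly set \<Rightarrow> bool" where
  "monomial_ideal M \<longleftrightarrow> (\<exists>S. M = ideal_gen (dmonom ` S))"

text \<open>The weights \<open>w'\<close> attached to the index \<open>i\<close>: either \<open>- e\<^sub>i\<close> or a perturbation of it.
  The equation between initial ideals holds for all sufficiently small \<open>\<epsilon> > 0\<close>, and the
  results depend on \<open>w'\<close> only through the initial ideal.\<close>

definition admissible_weight :: "int ^ 'n ^ 'd \<Rightarrow> 'n::finite \<Rightarrow> real ^ 'n \<Rightarrow> bool" where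
  "admissible_weight A i w' \<longleftrightarrow>
     (let J = initial_ideal (- axis i 1) (toric_ideal A) in
      if monomial_ideal J then w' = - axis i 1
      else \<exists>w \<epsilon>. \<epsilon> > 0 \<and> w' = - axis i 1 + \<epsilon> *\<^sub>R w
             \<and> initial_ideal w' (toric_ideal A) = initial_ideal w J
             \<and> monomial_ideal (initial_ideal w' (toric_ideal A)))"

definition standard_pair :: "'n::finite dpoly set \<Rightarrow> nat ^ 'n \<Rightarrow> 'n set \<Rightarrow> bool" where
  "standard_pair M \<eta> \<sigma> \<longleftrightarrow>
     (\<forall>i\<in>\<sigma>. \<eta> $ i = 0) \<and>
     (\<forall>\<mu>. (\<forall>i. i \<notin> \<sigma> \<longrightarrow> \<mu> $ i = 0) \<longrightarrow> dmonom (\<eta> + \<mu>) \<notin> M) \<and>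
     (\<forall>l. l \<notin> \<sigma> \<longrightarrow>
        (\<exists>\<mu>. (\<forall>i. i \<notin> insert l \<sigma> \<longrightarrow> \<mu> $ i = 0) \<and> dmonom (\<eta> + \<mu>) \<in> M))"

subsection \<open>Exponents\<close>

definition complex_vec :: "int ^ 'n \<Rightarrow> complex ^ 'n" where
  "complex_vec u = (\<chi> j. of_int (u $ j))"

definition complex_mat :: "int ^ 'n ^ 'd \<Rightarrow> complex ^ 'n::finite ^ 'd::finite" where
  "complex_mat A = map_matrix of_int A"

definition real_mat :: "int ^ 'n ^ 'd \<Rightarrow> real ^ 'n::finite ^ 'd::finite" where
  "real_mat A = map_matrix of_int A"

definition pos_part :: "int ^ 'n \<Rightarrow> int ^ 'n" where
  "pos_part u = (\<chi> j. max (u $ j) 0)"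

definition fake_exponent ::
  "int ^ 'n ^ 'd \<Rightarrow> complex ^ 'd \<Rightarrow> real ^ 'n \<Rightarrow> complex ^ 'n::finite \<Rightarrow> bool" where
  "fake_exponent A \<beta> w u \<longleftrightarrow>
     complex_mat A *v u = \<beta> \<and>
     (\<exists>\<eta> \<sigma>. standard_pair (initial_ideal w (toric_ideal A)) \<eta> \<sigma> \<and>
            (\<forall>i. i \<notin> \<sigma> \<longrightarrow> u $ i = of_nat (\<eta> $ i)))"

definition nsupp :: "complex ^ 'n \<Rightarrow> 'n set" where
  "nsupp u = {i. \<exists>k::int. k < 0 \<and> u $ i = of_int k}"

definition min_neg_support :: "int ^ 'n ^ 'd \<Rightarrow> complex ^ 'n::finite \<Rightarrow> bool" where
  "min_neg_support A u \<longleftrightarrow>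
     (\<forall>v'. A *v v' = 0 \<longrightarrow> nsupp (u + complex_vec v') \<subseteq> nsupp u \<longrightarrow>
           nsupp (u + complex_vec v') = nsupp u)"

text \<open>The subfield of \<open>\<complex>\<close> generated by \<open>S\<close>, that is, \<open>\<rat>(S)\<close>: every subfield contains \<open>\<rat>\<close>.\<close>

definition complex_subfield :: "complex set \<Rightarrow> bool" where
  "complex_subfield F \<longleftrightarrow> 0 \<in> F \<and> 1 \<in> F \<and>
     (\<forall>x\<in>F. \<forall>y\<in>F. x - y \<in> F \<and> x * y \<in> F) \<and> (\<forall>x\<in>F. inverse x \<in> F)"

definition rat_adjoin :: "complex set \<Rightarrow> complex set" where
  "rat_adjoin S = \<Inter>{F. complex_subfield F \<and> S \<subseteq> F}"

subsection \<open>The Weyl algebra\<close>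

text \<open>
  Elements of the Weyl algebra in normally ordered form: the key \<open>(a, b)\<close> stands for the
  operator \<open>x\<^sup>a \<partial>\<^sup>b\<close>. The commutative product that the type inherits from
  \<^typ>\<open>'a \<Rightarrow>\<^sub>0 'b\<close> is not the product of the Weyl algebra and is not used. Left multiplication
  by the algebra generators \<open>x\<^sub>i\<close> and \<open>\<partial>\<^sub>i\<close> is given by
  \<open>x\<^sub>i (x\<^sup>a \<partial>\<^sup>b) = x\<^sup>a\<^sup>+\<^sup>e\<^sup>i \<partial>\<^sup>b\<close> and
  \<open>\<partial>\<^sub>i (x\<^sup>a \<partial>\<^sup>b) = x\<^sup>a \<partial>\<^sup>b\<^sup>+\<^sup>e\<^sup>i + a\<^sub>i x\<^sup>a\<^sup>-\<^sup>e\<^sup>i \<partial>\<^sup>b\<close>.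
\<close>

type_synonym 'n weyl = "(nat ^ 'n) \<times> (nat ^ 'n) \<Rightarrow>\<^sub>0 complex"

definition weyl_x :: "'n \<Rightarrow> 'n::finite weyl \<Rightarrow> 'n weyl" where
  "weyl_x i P = (\<Sum>(a, b) \<in> Poly_Mapping.keys P.
     Poly_Mapping.single (a + axis i 1, b) (Poly_Mapping.lookup P (a, b)))"

definition weyl_d :: "'n \<Rightarrow> 'n::finite weyl \<Rightarrow> 'n weyl" where
  "weyl_d i P = (\<Sum>(a, b) \<in> Poly_Mapping.keys P.
     Poly_Mapping.single (a, b + axis i 1) (Poly_Mapping.lookup P (a, b)) +
     Poly_Mapping.single (a - axis i 1, b) (of_nat (a $ i) * Poly_Mapping.lookup P (a, b)))"

text \<open>Since the scalars, the \<open>x\<^sub>i\<close> and the \<open>\<partial>\<^sub>i\<close> generate the Weyl algebra, a left ideal is a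
  linear subspace that is stable under left multiplication by the \<open>x\<^sub>i\<close> and \<open>\<partial>\<^sub>i\<close>.\<close>

inductive_set weyl_left_ideal :: "'n::finite weyl set \<Rightarrow> 'n weyl set" for G where
  zero: "0 \<in> weyl_left_ideal G"
| gen: "P \<in> G \<Longrightarrow> P \<in> weyl_left_ideal G"
| add: "P \<in> weyl_left_ideal G \<Longrightarrow> Q \<in> weyl_left_ideal G \<Longrightarrow> P + Q \<in> weyl_left_ideal G"
| scale: "P \<in> weyl_left_ideal G \<Longrightarrow> Poly_Mapping.map ((*) c) P \<in> weyl_left_ideal G"
| mult_x: "P \<in> weyl_left_ideal G \<Longrightarrow> weyl_x i P \<in> weyl_left_ideal G"
| mult_d: "P \<in> weyl_left_ideal G \<Longrightarrow> weyl_d i P \<in> weyl_left_ideal G"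

definition weyl_of_dpoly :: "'n::finite dpoly \<Rightarrow> 'n weyl" where
  "weyl_of_dpoly p = (\<Sum>b \<in> Poly_Mapping.keys p.
     Poly_Mapping.single (0, b) (Poly_Mapping.lookup p b))"

definition euler_op :: "int ^ 'n ^ 'd \<Rightarrow> complex ^ 'd \<Rightarrow> 'd \<Rightarrow> 'n::finite weyl" where
  "euler_op A \<beta> i =
     (\<Sum>j\<in>UNIV. Poly_Mapping.single (axis j 1, axis j 1) (of_int (A $ i $ j)))
       - Poly_Mapping.single (0, 0) (\<beta> $ i)"

definition hypergeometric_ideal ::
  "int ^ 'n ^ 'd \<Rightarrow> complex ^ 'd \<Rightarrow> 'n::finite weyl set" where
  "hypergeometric_ideal A \<beta> =
     weyl_left_ideal (weyl_of_dpoly ` toric_ideal A \<union> range (euler_op A \<beta>))"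

subsection \<open>Holomorphic functions of several variables and solutions\<close>

definition holomorphic_sev_on :: "(complex ^ 'n \<Rightarrow> complex) \<Rightarrow> (complex ^ 'n::finite) set \<Rightarrow> bool"
  where "holomorphic_sev_on f U \<longleftrightarrow>
     (\<forall>x\<in>U. \<exists>f'. (f has_derivative f') (at x) \<and> (\<forall>c h. f' (c *s h) = c * f' h))"

definition cpartial :: "'n \<Rightarrow> (complex ^ 'n \<Rightarrow> complex) \<Rightarrow> complex ^ 'n::finite \<Rightarrow> complex" where
  "cpartial i f x = deriv (\<lambda>t. f (x + axis i t)) 0"

text \<open>The order in which the partial derivatives are taken is immaterial for holomorphic
  functions.\<close>

definition multi_cpartial ::
  "nat ^ 'n \<Rightarrow> (complex ^ 'n \<Rightarrow> complex) \<Rightarrow> complex ^ 'n::finite \<Rightarrow> complex" where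
  "multi_cpartial b f = foldr cpartial (SOME is. \<forall>i. count_list is i = b $ i) f"

definition weyl_apply ::
  "'n weyl \<Rightarrow> (complex ^ 'n \<Rightarrow> complex) \<Rightarrow> complex ^ 'n::finite \<Rightarrow> complex" where
  "weyl_apply P f x = (\<Sum>(a, b) \<in> Poly_Mapping.keys P.
     Poly_Mapping.lookup P (a, b) * (\<Prod>j\<in>UNIV. x $ j ^ (a $ j)) * multi_cpartial b f x)"

text \<open>Functions on the open set \<open>U\<close> are represented by total functions that vanish outside \<open>U\<close>,
  so that equality of representatives is equality on \<open>U\<close>.\<close>

definition solutions ::
  "(complex ^ 'n) set \<Rightarrow> 'n weyl set \<Rightarrow> (complex ^ 'n::finite \<Rightarrow> complex) set" where
  "solutions U H = {f. holomorphic_sev_on f U \<and> (\<forall>x. x \<notin> U \<longrightarrow> f x = 0) \<and>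
     (\<forall>P\<in>H. \<forall>x\<in>U. weyl_apply P f x = 0)}"

definition cpartial_on ::
  "(complex ^ 'n) set \<Rightarrow> 'n \<Rightarrow> (complex ^ 'n \<Rightarrow> complex) \<Rightarrow> complex ^ 'n::finite \<Rightarrow> complex" where
  "cpartial_on U i f = (\<lambda>x. if x \<in> U then cpartial i f x else 0)"

text \<open>\<open>L i\<close> is the chosen branch of \<open>log x\<^sub>i\<close> on \<open>U\<close>.\<close>

definition log_branches :: "(complex ^ 'n::finite) set \<Rightarrow> ('n \<Rightarrow> complex ^ 'n \<Rightarrow> complex) \<Rightarrow> bool" where
  "log_branches U L \<longleftrightarrow> (\<forall>i. continuous_on U (L i) \<and> (\<forall>x\<in>U. exp (L i x) = x $ i))"

definition cmonomial_on ::
  "(complex ^ 'n) set \<Rightarrow> ('n \<Rightarrow> complex ^ 'n \<Rightarrow> complex) \<Rightarrow> complex ^ 'n \<Rightarrow>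
   complex ^ 'n::finite \<Rightarrow> complex" where
  "cmonomial_on U L u = (\<lambda>x. if x \<in> U then \<Prod>i\<in>UNIV. exp (u $ i * L i x) else 0)"

definition fun_scale :: "complex \<Rightarrow> ('a \<Rightarrow> complex) \<Rightarrow> 'a \<Rightarrow> complex" where
  "fun_scale c f = (\<lambda>x. c * f x)"

lemma module_fun_scale: "module fun_scale"
  by unfold_locales (auto simp: fun_scale_def fun_eq_iff algebra_simps)

definition fun_span :: "('a \<Rightarrow> complex) set \<Rightarrow> ('a \<Rightarrow> complex) set" where
  "fun_span = module.span fun_scale"

definition linear_map_between ::
  "('a \<Rightarrow> complex) set \<Rightarrow> ('a \<Rightarrow> complex) set \<Rightarrow>
   (('a \<Rightarrow> complex) \<Rightarrow> 'a \<Rightarrow> complex) \<Rightarrow> bool" where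
  "linear_map_between X Y T \<longleftrightarrow> T ` X \<subseteq> Y \<and>
     (\<forall>f\<in>X. \<forall>g\<in>X. T (f + g) = T f + T g) \<and>
     (\<forall>c. \<forall>f\<in>X. T (fun_scale c f) = fun_scale c (T f))"

end

theory Submission
  imports
    Defs
    "HOL-Complex_Analysis.Cauchy_Integral_Formula"
    "HOL-Computational_Algebra.Fundamental_Theorem_Algebra"
begin

text \<open>
  Let \<open>m\<close> span the part of the kernel of \<open>A\<close> with vanishing coordinate \<open>i3\<close>. By the Euler
  equations, a solution \<open>\<psi>\<close> with \<open>\<partial>\<^sub>3 \<psi> = 0\<close> is \<open>x\<^sup>v\<close> times a function of the single quantity \<open>x\<^sup>m\<close>.
  If \<open>z\<close> is an integer vector with \<open>(Bz)\<^sub>3 < 0\<close>, the binomial of \<open>Bz\<close> shows that the positive part of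
  \<open>Bz\<close> annihilates \<open>\<psi>\<close>; this is a differential equation with constant coefficients in \<open>log x\<^sup>m\<close> whose
  characteristic polynomial is nonzero at \<open>t\<close> as soon as \<open>(Bz)\<^sub>j \<le> u\<^sub>j\<close> for all coordinates \<open>u\<^sub>j\<close> of
  \<open>u = v + t m\<close> in \<open>\<nat>\<close>. For \<open>t \<noteq> 0\<close> such a \<open>z\<close> always exists: if \<open>\<mu>\<close> denotes the real vector with
  \<open>B\<mu> = tm\<close>, then some point of \<open>\<int>\<^sup>2\<close> lies in the translated unit square \<open>\<mu> + [0, 1)\<^sup>2\<close>, and the
  choice of \<open>v\<close> makes every noncorner point of this square admissible; the remaining cases use the
  genericity of \<open>\<alpha>\<close>. At \<open>t = 0\<close> the polynomial of \<open>z = (1, 0)\<close> has a simple root. Hence the kernel is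
  spanned by \<open>x\<^sup>v\<close> or is zero, according to whether such a \<open>z\<close> is missing for \<open>t = 0\<close>. The same
  condition on \<open>u\<close> decides whether \<open>u\<close> is a fake exponent, since \<open>Bz\<close> witnesses membership of a
  monomial in the initial ideal.
\<close>

section \<open>Holomorphic functions of several variables\<close>

text \<open>The total derivative is recorded by complex coefficients, so complex linearity is built
  in and derivatives can be computed by coordinatewise rules.\<close>

definition has_cgradient ::
  "(complex ^ 'n::finite \<Rightarrow> complex) \<Rightarrow> ('n \<Rightarrow> complex) \<Rightarrow> complex ^ 'n \<Rightarrow> bool" where
  "has_cgradient f c x \<longleftrightarrow> (f has_derivative (\<lambda>h. \<Sum>j\<in>UNIV. h $ j * c j)) (at x)"

lemma norm_axis: "norm (axis i (t::complex)) = norm t"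
proof -
  have "norm (axis i t) ^ 2 = norm t ^ 2"
    by (simp add: power2_norm_eq_inner inner_axis_axis)
  then show ?thesis by simp
qed

lemma bounded_linear_axis: "bounded_linear (axis i :: complex \<Rightarrow> complex ^ 'n::finite)"
  by (rule bounded_linear_intro[where K = 1])
    (simp_all add: norm_axis, simp_all add: axis_def vec_eq_iff)

text \<open>\<open>cpartial\<close> is a \<open>deriv\<close> and means something only where that
  derivative exists; the chain rule along the line \<open>x + axis i t\<close> provides
  this.\<close>

lemma has_cgradient_cpartial:
  assumes "has_cgradient f c x"
  shows "((\<lambda>t. f (x + axis i t)) has_field_derivative c i) (at 0)" "cpartial i f x = c i"
proof -
  have "((\<lambda>t. x + axis i t) has_derivative (\<lambda>t. axis i t)) (at (0::complex))"
    using bounded_linear_axis[of i]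
    by (auto intro!: derivative_eq_intros bounded_linear_imp_has_derivative)
  moreover have "(f has_derivative (\<lambda>h. \<Sum>j\<in>UNIV. h $ j * c j)) (at (x + axis i 0))"
    using assms by (simp add: has_cgradient_def axis_eq_0_iff[THEN iffD2])
  ultimately have "((\<lambda>t. f (x + axis i t)) has_derivative
      (\<lambda>t. \<Sum>j\<in>UNIV. axis i t $ j * c j)) (at 0)"
    by (rule has_derivative_compose)
  moreover have "(\<Sum>j\<in>UNIV. axis i t $ j * c j) = c i * t" for t
    by (simp add: axis_def if_distrib[of "\<lambda>y. y * _"] cong: if_cong)
  ultimately show "((\<lambda>t. f (x + axis i t)) has_field_derivative c i) (at 0)"
    by (simp add: has_field_derivative_def)
  then show "cpartial i f x = c i"
    unfolding cpartial_def by (rule DERIV_imp_deriv)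
qed

lemma holomorphic_sev_onI:
  assumes "\<And>x. x \<in> U \<Longrightarrow> has_cgradient f (c x) x"
  shows "holomorphic_sev_on f U"
  unfolding holomorphic_sev_on_def
proof
  fix x assume "x \<in> U"
  then have "(f has_derivative (\<lambda>h. \<Sum>j\<in>UNIV. h $ j * c x j)) (at x)"
    using assms has_cgradient_def by blast
  then show "\<exists>f'. (f has_derivative f') (at x) \<and> (\<forall>c h. f' (c *s h) = c * f' h)"
    by (intro exI[of _ "\<lambda>h. \<Sum>j\<in>UNIV. h $ j * c x j"]) (auto simp: sum_distrib_left mult.assoc)
qed

lemma has_derivative_imp_has_cgradient:
  assumes d: "(f has_derivative f') (at x)" and lin: "\<And>c h. f' (c *s h) = c * f' h"
  shows "has_cgradient f (\<lambda>j. f' (axis j 1)) x"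
proof -
  have l: "linear f'" using d has_derivative_linear by blast
  have "f' h = (\<Sum>j\<in>UNIV. h $ j * f' (axis j 1))" for h
  proof -
    have "f' h = f' (\<Sum>j\<in>UNIV. h $ j *s axis j 1)" by (simp add: basis_expansion)
    also have "\<dots> = (\<Sum>j\<in>UNIV. f' (h $ j *s axis j 1))" by (rule linear_sum[OF l])
    finally show ?thesis by (simp add: lin)
  qed
  then show ?thesis using d unfolding has_cgradient_def by (metis (no_types, lifting) ext)
qed

lemma holomorphic_sev_on_cgradient:
  assumes "holomorphic_sev_on f U" "x \<in> U"
  shows "has_cgradient f (\<lambda>j. cpartial j f x) x"
proof -
  obtain f' where d: "(f has_derivative f') (at x)" "\<And>c h. f' (c *s h) = c * f' h"
    using assms unfolding holomorphic_sev_on_def by blast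
  from has_derivative_imp_has_cgradient[OF this] show ?thesis
    using has_cgradient_cpartial(2)[of f _ x] by simp
qed

lemma has_cgradient_unique: "has_cgradient f c x \<Longrightarrow> has_cgradient f c' x \<Longrightarrow> c = c'"
  using has_cgradient_cpartial(2) by (metis ext)

text \<open>Derivatives are local; this lets a function be replaced by a formula that holds only on
  \<open>U\<close>.\<close>

lemma has_cgradient_cong:
  assumes "open U" "x \<in> U" "\<And>y. y \<in> U \<Longrightarrow> f y = g y"
  shows "has_cgradient f c x \<longleftrightarrow> has_cgradient g c x"
  unfolding has_cgradient_def
  using assms has_derivative_transform_within_open[of f _ x UNIV U g]
    has_derivative_transform_within_open[of g _ x UNIV U f] by auto

lemma holomorphic_sev_on_cong:
  assumes "open U" "\<And>y. y \<in> U \<Longrightarrow> f y = g y" "holomorphic_sev_on f U"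
  shows "holomorphic_sev_on g U"
  using holomorphic_sev_onI[of U g "\<lambda>x j. cpartial j f x"] has_cgradient_cong[of U _ f g]
    holomorphic_sev_on_cgradient assms by blast

lemma cpartial_cong:
  assumes "open U" "x \<in> U" "\<And>y. y \<in> U \<Longrightarrow> f y = g y" "holomorphic_sev_on f U"
  shows "cpartial i f x = cpartial i g x"
  using has_cgradient_cpartial(2)[of g _ x i] has_cgradient_cong[of U x f g]
    holomorphic_sev_on_cgradient assms by metis

section \<open>Differentiation rules for complex gradients\<close>

lemma has_cgradient_add:
  "has_cgradient f c x \<Longrightarrow> has_cgradient g d x \<Longrightarrow>
    has_cgradient (\<lambda>y. f y + g y) (\<lambda>j. c j + d j) x"
  unfolding has_cgradient_def
  by (auto intro!: derivative_eq_intros simp: sum.distrib algebra_simps)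

lemma has_cgradient_mult:
  "has_cgradient f c x \<Longrightarrow> has_cgradient g d x \<Longrightarrow>
    has_cgradient (\<lambda>y. f y * g y) (\<lambda>j. f x * d j + c j * g x) x"
  unfolding has_cgradient_def
  by (auto intro!: derivative_eq_intros
      simp: sum.distrib sum_distrib_left sum_distrib_right algebra_simps)

lemma has_cgradient_const: "has_cgradient (\<lambda>y. a) (\<lambda>j. 0) x"
  unfolding has_cgradient_def by simp

lemma has_cgradient_cmult:
  "has_cgradient f c x \<Longrightarrow> has_cgradient (\<lambda>y. a * f y) (\<lambda>j. a * c j) x"
  using has_cgradient_mult[OF has_cgradient_const, of f c x a] by simp

lemma has_cgradient_sum:
  assumes "\<And>k. k \<in> K \<Longrightarrow> has_cgradient (f k) (c k) x"
  shows "has_cgradient (\<lambda>y. \<Sum>k\<in>K. f k y) (\<lambda>j. \<Sum>k\<in>K. c k j) x"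
  using assms
  by (induction K rule: infinite_finite_induct)
    (auto intro!: has_cgradient_add simp: has_cgradient_const)

lemma has_cgradient_nth: "has_cgradient (\<lambda>y. y $ i) (\<lambda>j. if j = i then 1 else 0) x"
proof -
  have "((\<lambda>y. y $ i) has_derivative (\<lambda>h. h $ i)) (at x)"
    by (rule bounded_linear_imp_has_derivative) (rule bounded_linear_vec_nth)
  then show ?thesis
    by (simp add: has_cgradient_def if_distrib[of "\<lambda>z. _ * z"] cong: if_cong)
qed

lemma has_cgradient_compose:
  assumes "has_cgradient f c x" "(g has_field_derivative g') (at (f x))"
  shows "has_cgradient (\<lambda>y. g (f y)) (\<lambda>j. g' * c j) x"
proof -
  have "((\<lambda>y. g (f y)) has_derivative (\<lambda>h. g' * (\<Sum>j\<in>UNIV. h $ j * c j))) (at x)"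
    using has_derivative_compose[of f _ x UNIV g "(*) g'"] assms
    unfolding has_cgradient_def has_field_derivative_def by blast
  then show ?thesis
    by (simp add: has_cgradient_def sum_distrib_left mult.left_commute)
qed

text \<open>Each factor is described by its logarithmic derivative \<open>c k j\<close>. These add
  up over a product, and in this form no factor has to be divided out.\<close>

lemma has_cgradient_prod:
  assumes "finite K" "\<And>k. k \<in> K \<Longrightarrow> has_cgradient (f k) (\<lambda>j. c k j * f k x) x"
  shows "has_cgradient (\<lambda>y. \<Prod>k\<in>K. f k y) (\<lambda>j. (\<Sum>k\<in>K. c k j) * (\<Prod>k\<in>K. f k x)) x"
  using assms
proof (induction K)
  case (insert k K)
  have "has_cgradient (\<lambda>y. f k y * (\<Prod>k\<in>K. f k y))
     (\<lambda>j. f k x * ((\<Sum>k\<in>K. c k j) * (\<Prod>k\<in>K. f k x)) + c k j * f k x * (\<Prod>k\<in>K. f k x)) x"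
    using insert by (intro has_cgradient_mult) auto
  then show ?case using insert.hyps by (simp add: algebra_simps)
qed (simp add: has_cgradient_const)

section \<open>Cauchy's integral formula, regularity and symmetry of partial derivatives\<close>

lemma cpartial_Cauchy:
  fixes f :: "complex ^ 'n::finite \<Rightarrow> complex"
  assumes f: "holomorphic_sev_on f U" and r: "r > 0" "cball x r \<subseteq> U"
  shows "cpartial i f x =
    integral (cbox 0 1) (\<lambda>t. f (x + axis i (r * exp (2 * of_real pi * \<i> * of_real t))) /
      (r * exp (2 * of_real pi * \<i> * of_real t)))"
proof -
  \<comment> \<open>The one-variable formula for the first derivative is applied on the
    \<open>i\<close>-th coordinate line through \<open>x\<close>; the factor
    \<open>2 * pi * \<i>\<close> is then cancelled against the velocity of the circle.\<close>
  define F where "F = (\<lambda>t. f (x + axis i t))"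
  have sub: "x + axis i t \<in> U" if "t \<in> cball 0 r" for t
    using that r(2) by (auto simp: subset_iff dist_norm norm_axis)
  have F': "(F has_field_derivative cpartial i f (x + axis i t)) (at t)" if "t \<in> cball 0 r" for t
  proof -
    have "((\<lambda>s. f (x + axis i t + axis i s)) has_field_derivative cpartial i f (x + axis i t)) (at 0)"
      by (rule has_cgradient_cpartial(1)[OF holomorphic_sev_on_cgradient[OF f sub[OF that]]])
    moreover have "(\<lambda>s. f (x + axis i t + axis i s)) = (\<lambda>s. F (s + t))"
      unfolding F_def by (intro ext arg_cong[of _ _ f]) (simp add: vec_eq_iff axis_def)
    ultimately show ?thesis
      using DERIV_shift[of F "cpartial i f (x + axis i t)" 0 t] by simp
  qed
  have "((\<lambda>u. F u / (u - 0) ^ Suc 1) has_contour_integral (2 * pi * \<i>) / (fact 1) * (deriv ^^ 1) F 0)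
       (circlepath 0 r)"
  proof (rule Cauchy_has_contour_integral_higher_derivative_circlepath)
    show "continuous_on (cball 0 r) F"
      using F' by (auto intro!: continuous_at_imp_continuous_on DERIV_isCont)
    show "F holomorphic_on ball 0 r"
      unfolding holomorphic_on_def field_differentiable_def
    proof
      fix t assume "t \<in> ball (0::complex) r"
      then have "(F has_field_derivative cpartial i f (x + axis i t)) (at t within ball 0 r)"
        by (auto intro: has_field_derivative_at_within[OF F'])
      then show "\<exists>f'. (F has_field_derivative f') (at t within ball 0 r)" ..
    qed
  qed (use r in auto)
  moreover have "deriv F 0 = cpartial i f x"
    by (simp add: F_def cpartial_def)
  ultimately have "((\<lambda>u. F u / u\<^sup>2) has_contour_integral (2 * pi * \<i>) * cpartial i f x) (circlepath 0 r)"
    by (simp add: numeral_2_eq_2)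
  then have "((\<lambda>t. F (circlepath 0 r t) / (circlepath 0 r t)\<^sup>2 *
      vector_derivative (circlepath 0 r) (at t within {0..1})) has_integral (2 * pi * \<i>) * cpartial i f x) {0..1}"
    by (simp add: has_contour_integral_def)
  then have "((\<lambda>t. (2 * pi * \<i>) * (F (r * exp (2 * of_real pi * \<i> * of_real t)) /
      (r * exp (2 * of_real pi * \<i> * of_real t))))
      has_integral (2 * pi * \<i>) * cpartial i f x) {0..1}"
  proof (rule has_integral_eq[rotated])
    fix t :: real assume "t \<in> {0..1}"
    then show "F (circlepath 0 r t) / (circlepath 0 r t)\<^sup>2 *
      vector_derivative (circlepath 0 r) (at t within {0..1}) =
      (2 * pi * \<i>) * (F (r * exp (2 * of_real pi * \<i> * of_real t)) /
      (r * exp (2 * of_real pi * \<i> * of_real t)))"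
      using r(1) by (simp add: vector_derivative_circlepath01)
        (simp add: circlepath power2_eq_square)
  qed
  from has_integral_mult_right[OF this, of "inverse (2 * pi * \<i>)"]
  have "((\<lambda>t. inverse (2 * pi * \<i>) * ((2 * pi * \<i>) * (F (r * exp (2 * of_real pi * \<i> * of_real t)) /
      (r * exp (2 * of_real pi * \<i> * of_real t))))) has_integral
      inverse (2 * pi * \<i>) * ((2 * pi * \<i>) * cpartial i f x)) {0..1}" .
  moreover have "inverse (2 * pi * \<i>) * ((2 * pi * \<i>) * z) = z" for z :: complex
    by (simp add: field_simps)
  ultimately have "((\<lambda>t. F (r * exp (2 * of_real pi * \<i> * of_real t)) /
      (r * exp (2 * of_real pi * \<i> * of_real t))) has_integral cpartial i f x) {0..1}"
    by (simp only:)
  then show ?thesis unfolding F_def cbox_interval by (rule integral_unique[symmetric])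
qed

lemma holomorphic_sev_on_continuous_on: "holomorphic_sev_on f U \<Longrightarrow> continuous_on U f"
  unfolding holomorphic_sev_on_def
  by (auto intro!: continuous_at_imp_continuous_on dest!: bspec has_derivative_continuous)

text \<open>The radius is doubled because a circle of radius \<open>r\<close> about a point of
  \<open>ball x0 r\<close> stays inside \<open>cball x0 (2 * r)\<close>.\<close>

lemma continuous_on_circle_integrand:
  fixes f :: "complex ^ 'n::finite \<Rightarrow> complex"
  assumes f: "continuous_on U f" and r: "r > 0" "cball x0 (2 * r) \<subseteq> U"
  shows "continuous_on (ball x0 r \<times> cbox 0 1)
    (\<lambda>(x, t). f (x + axis i (complex_of_real r * exp (2 * of_real pi * \<i> * of_real t))) /
      (r * exp (2 * of_real pi * \<i> * of_real t)))"
proof -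
  have ax: "continuous_on S (\<lambda>z. axis i (g z) :: complex ^ 'n)" if "continuous_on S g" for S g
    using bounded_linear.continuous_on[OF bounded_linear_axis that] .
  have "continuous_on (ball x0 r \<times> cbox 0 1)
    (\<lambda>z. f (fst z + axis i (complex_of_real r * exp (2 * of_real pi * \<i> * of_real (snd z)))))"
  proof (rule continuous_on_compose2[OF f])
    show "(\<lambda>z. fst z + axis i (complex_of_real r * exp (2 * of_real pi * \<i> * of_real (snd z))))
       ` (ball x0 r \<times> cbox 0 1) \<subseteq> U"
    proof safe
      fix x t assume "x \<in> ball x0 r"
      then have "dist x0 (x + axis i (complex_of_real r * exp (2 * of_real pi * \<i> * of_real t))) \<le> 2 * r"
        using norm_triangle_ineq4[of "x0 - x" "axis i (complex_of_real r * exp (2 * of_real pi * \<i> * of_real t))"] r(1)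
        by (simp add: dist_norm norm_axis norm_mult diff_diff_add)
      then show "fst (x, t) + axis i (complex_of_real r * exp (2 * of_real pi * \<i> * of_real (snd (x, t)))) \<in> U"
        using r(2) by auto
    qed
  qed (intro continuous_intros ax)
  then show ?thesis
    using r(1) by (auto simp: case_prod_unfold intro!: continuous_intros)
qed

lemma cball_subset_of_mem_ball:
  fixes x :: "'a::real_normed_vector"
  assumes "x \<in> ball x0 r" "cball x0 (2 * r) \<subseteq> U"
  shows "cball x r \<subseteq> U"
proof
  fix y assume "y \<in> cball x r"
  then have "dist x0 y \<le> 2 * r"
    using dist_triangle[of x0 y x] assms(1) by (simp add: dist_commute)
  then show "y \<in> U" using assms(2) by auto
qed

text \<open>Cauchy's formula writes the partial derivative as a parameter integral over values of
  \<open>f\<close>, so continuity of \<open>f\<close> passes to it.\<close>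

lemma cpartial_continuous_on:
  fixes f :: "complex ^ 'n::finite \<Rightarrow> complex"
  assumes f: "holomorphic_sev_on f U" and U: "open U"
  shows "continuous_on U (cpartial i f)"
proof -
  have "isCont (cpartial i f) x0" if x0: "x0 \<in> U" for x0
  proof -
    obtain s where s: "s > 0" "cball x0 s \<subseteq> U"
      using U x0 open_contains_cball by blast
    define r where "r = s / 2"
    have r: "r > 0" "cball x0 (2 * r) \<subseteq> U" using s by (auto simp: r_def)
    have "continuous_on (ball x0 r) (\<lambda>x. integral (cbox 0 1)
        (\<lambda>t. f (x + axis i (complex_of_real r * exp (2 * of_real pi * \<i> * of_real t))) /
        (r * exp (2 * of_real pi * \<i> * of_real t))))"
      using continuous_on_circle_integrand[OF holomorphic_sev_on_continuous_on[OF f] r, of i]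
      by (rule integral_continuous_on_param)
    then have "continuous_on (ball x0 r) (cpartial i f)"
      by (rule continuous_on_eq)
        (rule cpartial_Cauchy[OF f r(1) cball_subset_of_mem_ball[OF _ r(2)], symmetric])
    then show ?thesis using r(1) continuous_on_eq_continuous_at[OF open_ball] centre_in_ball by blast
  qed
  then show ?thesis using continuous_at_imp_continuous_on by blast
qed

lemma bounded_linear_cgradient: "bounded_linear (\<lambda>h::complex ^ 'n::finite. \<Sum>j\<in>UNIV. h $ j * c j)"
  by (intro bounded_linear_sum bounded_linear_mult_left
      bounded_linear_compose[OF bounded_linear_mult_left] bounded_linear_vec_nth)

text \<open>Differentiating Cauchy's formula under the integral sign shows that the gradient of
  \<open>cpartial i f\<close> has the Cauchy integrals of the \<open>cpartial j f\<close> as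
  coefficients. This gives differentiability, and a second use of Cauchy's formula gives the
  symmetry.\<close>

lemma
  fixes f :: "complex ^ 'n::finite \<Rightarrow> complex"
  assumes f: "holomorphic_sev_on f U" and U: "open U"
  shows holomorphic_sev_on_cpartial: "holomorphic_sev_on (cpartial i f) U"
    and cpartial_commute: "x \<in> U \<Longrightarrow> cpartial j (cpartial i f) x = cpartial i (cpartial j f) x"
proof -
  \<comment> \<open>\<open>leibniz_rule\<close> needs the derivative of the integrand as a
    continuous family of bounded linear maps; \<open>D x t\<close> is this map, already divided by
    the point \<open>t\<close> of the circle.\<close>
  define D where "D x t = Blinfun (\<lambda>h. \<Sum>j\<in>UNIV. h $ j * (cpartial j f x / t))" for x t
  have D: "blinfun_apply (D x t) = (\<lambda>h. \<Sum>j\<in>UNIV. h $ j * (cpartial j f x / t))" for x t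
    unfolding D_def by (rule bounded_linear_Blinfun_apply[OF bounded_linear_cgradient])
  have *: "\<exists>r>0. cball x0 r \<subseteq> U \<and> has_cgradient (cpartial i f)
        (\<lambda>j. integral (cbox 0 1) (\<lambda>t. cpartial j f (x0 + axis i (r * exp (2 * of_real pi * \<i> * of_real t))) /
        (r * exp (2 * of_real pi * \<i> * of_real t)))) x0" if x0: "x0 \<in> U" for x0 i
  proof -
    obtain s where s: "s > 0" "cball x0 s \<subseteq> U"
      using U x0 open_contains_cball by blast
    define r where "r = s / 2"
    have r: "r > 0" "cball x0 (2 * r) \<subseteq> U" using s by (auto simp: r_def)
    define e where "e t = complex_of_real r * exp (2 * of_real pi * \<i> * of_real t)" for t
    have inU: "x + axis i (e t) \<in> U" if "x \<in> ball x0 r" for x t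
      using cball_subset_of_mem_ball[OF that r(2)] r(1)
      by (auto simp: subset_iff dist_norm norm_axis e_def norm_mult)
    have contD: "continuous_on (ball x0 r \<times> cbox 0 1) (\<lambda>(x, t). D (x + axis i (e t)) (e t))"
      unfolding case_prod_unfold
    proof (rule continuous_on_blinfun_componentwise)
      fix b :: "complex ^ 'n"
      have "continuous_on (ball x0 r \<times> cbox 0 1)
         (\<lambda>z. cpartial j f (fst z + axis i (e (snd z))) / e (snd z))" for j
        using continuous_on_circle_integrand[OF cpartial_continuous_on[OF f U] r, of j i]
        by (simp add: case_prod_unfold e_def)
      then show "continuous_on (ball x0 r \<times> cbox 0 1)
          (\<lambda>z. blinfun_apply (D (fst z + axis i (e (snd z))) (e (snd z))) b)"
        unfolding D by (intro continuous_on_sum continuous_on_mult continuous_on_const)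
    qed
    have x0b: "x0 \<in> ball x0 r" using r(1) by simp
    have "((\<lambda>x. integral (cbox 0 1) (\<lambda>t. f (x + axis i (e t)) / e t)) has_derivative
        blinfun_apply (integral (cbox 0 1) (\<lambda>t. D (x0 + axis i (e t)) (e t)))) (at x0 within ball x0 r)"
    proof (rule leibniz_rule[OF _ _ contD])
      fix x t assume x: "x \<in> ball x0 r"
      have "((\<lambda>x. x + axis i (e t)) has_derivative (\<lambda>h. h)) (at x)"
        by (auto intro!: derivative_eq_intros)
      moreover have "(f has_derivative (\<lambda>h. \<Sum>j\<in>UNIV. h $ j * cpartial j f (x + axis i (e t))))
          (at (x + axis i (e t)))"
        using holomorphic_sev_on_cgradient[OF f inU[OF x]] by (simp add: has_cgradient_def)
      ultimately have "((\<lambda>x. f (x + axis i (e t))) has_derivative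
          (\<lambda>h. \<Sum>j\<in>UNIV. h $ j * cpartial j f (x + axis i (e t)))) (at x)"
        by (rule has_derivative_compose)
      from has_derivative_mult_left[OF this, of "inverse (e t)"]
      have "((\<lambda>x. f (x + axis i (e t)) / e t) has_derivative blinfun_apply (D (x + axis i (e t)) (e t))) (at x)"
        by (simp add: D sum_distrib_right divide_inverse mult.assoc)
      then show "((\<lambda>x. f (x + axis i (e t)) / e t) has_derivative blinfun_apply (D (x + axis i (e t)) (e t)))
          (at x within ball x0 r)"
        by (rule has_derivative_at_withinI)
    next
      fix x assume x: "x \<in> ball x0 r"
      have "continuous_on (cbox 0 1) ((\<lambda>(x, t). f (x + axis i (e t)) / e t) \<circ> (\<lambda>t. (x, t)))"
        using continuous_on_circle_integrand[OF holomorphic_sev_on_continuous_on[OF f] r, of i] x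
        by (intro continuous_on_compose) (auto intro!: continuous_intros
            elim!: continuous_on_subset simp: e_def)
      then show "(\<lambda>t. f (x + axis i (e t)) / e t) integrable_on cbox 0 1"
        by (intro integrable_continuous) (simp add: o_def)
    qed (use x0b in auto)
    then have "((\<lambda>x. integral (cbox 0 1) (\<lambda>t. f (x + axis i (e t)) / e t)) has_derivative
        blinfun_apply (integral (cbox 0 1) (\<lambda>t. D (x0 + axis i (e t)) (e t)))) (at x0)"
      using at_within_open[OF x0b] by simp
    then have deriv: "(cpartial i f has_derivative
        blinfun_apply (integral (cbox 0 1) (\<lambda>t. D (x0 + axis i (e t)) (e t)))) (at x0)"
      unfolding e_def
      by (rule has_derivative_transform_within_open[OF _ open_ball x0b])
        (rule cpartial_Cauchy[OF f r(1) cball_subset_of_mem_ball[OF _ r(2)], symmetric])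
    have "continuous_on (cbox 0 1) ((\<lambda>(x, t). D (x + axis i (e t)) (e t)) \<circ> (\<lambda>t. (x0, t)))"
      using contD x0b by (intro continuous_on_compose) (auto intro!: continuous_intros
            elim!: continuous_on_subset)
    then have int: "(\<lambda>t. D (x0 + axis i (e t)) (e t)) integrable_on cbox 0 1"
      by (intro integrable_continuous) (simp add: o_def)
    have ap: "blinfun_apply (integral (cbox 0 1) (\<lambda>t. D (x0 + axis i (e t)) (e t))) h =
       integral (cbox 0 1) (\<lambda>t. \<Sum>j\<in>UNIV. h $ j * (cpartial j f (x0 + axis i (e t)) / e t))" for h
      unfolding blinfun_apply_integral[OF int] D ..
    have "has_cgradient (cpartial i f) (\<lambda>j. blinfun_apply (integral (cbox 0 1) (\<lambda>t. D (x0 + axis i (e t)) (e t)))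
          (axis j 1)) x0"
    proof (rule has_derivative_imp_has_cgradient[OF deriv])
      fix c h
      have "(\<Sum>j\<in>UNIV. (c *s h) $ j * (cpartial j f (x0 + axis i (e t)) / e t)) =
        c * (\<Sum>j\<in>UNIV. h $ j * (cpartial j f (x0 + axis i (e t)) / e t))" for t
        by (simp add: sum_distrib_left mult.assoc)
      then show "blinfun_apply (integral (cbox 0 1) (\<lambda>t. D (x0 + axis i (e t)) (e t))) (c *s h) =
         c * blinfun_apply (integral (cbox 0 1) (\<lambda>t. D (x0 + axis i (e t)) (e t))) h"
        unfolding ap by simp
    qed
    moreover have "(\<Sum>k\<in>UNIV. axis j 1 $ k * (y k :: complex)) = y j" for y and j :: 'n
      by (simp add: axis_def if_distrib[of "\<lambda>y. y * _"] cong: if_cong)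
    ultimately have "has_cgradient (cpartial i f)
        (\<lambda>j. integral (cbox 0 1) (\<lambda>t. cpartial j f (x0 + axis i (e t)) / e t)) x0"
      unfolding ap by (simp only:)
    moreover have "cball x0 r \<subseteq> U" using s by (auto simp: r_def)
    ultimately show ?thesis using r(1) unfolding e_def by blast
  qed
  show hol: "holomorphic_sev_on (cpartial i f) U" for i
  proof -
    have "\<exists>c. has_cgradient (cpartial i f) c x" if "x \<in> U" for x
      using *[OF that, of i] by blast
    then obtain c where "\<And>x. x \<in> U \<Longrightarrow> has_cgradient (cpartial i f) (c x) x"
      by metis
    then show ?thesis by (rule holomorphic_sev_onI)
  qed
  show "cpartial j (cpartial i f) x = cpartial i (cpartial j f) x" if x: "x \<in> U"
  proof -
    obtain r where r: "r > 0" "cball x r \<subseteq> U" and g: "has_cgradient (cpartial i f)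
        (\<lambda>j. integral (cbox 0 1) (\<lambda>t. cpartial j f (x + axis i (r * exp (2 * of_real pi * \<i> * of_real t))) /
        (r * exp (2 * of_real pi * \<i> * of_real t)))) x"
      using *[OF x, of i] by blast
    \<comment> \<open>The integral is the \<open>j\<close>-th coefficient of the gradient of
      \<open>cpartial i f\<close> and, by Cauchy's formula, also the \<open>i\<close>-th partial
      derivative of \<open>cpartial j f\<close>.\<close>
    show ?thesis
      unfolding has_cgradient_cpartial(2)[OF g] cpartial_Cauchy[OF hol[of j] r] ..
  qed
qed

section \<open>Toric ideals and iterated partial derivatives\<close>

text \<open>The linear extension of \<open>\<phi>\<close> from monomials; it serves for commutative
  polynomials and for normally ordered Weyl operators alike.\<close>

definition pm_eval :: "('a \<Rightarrow> complex) \<Rightarrow> ('a \<Rightarrow>\<^sub>0 complex) \<Rightarrow> complex" where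
  "pm_eval \<phi> p = (\<Sum>k\<in>Poly_Mapping.keys p. Poly_Mapping.lookup p k * \<phi> k)"

lemma pm_eval_superset:
  assumes "finite K" "Poly_Mapping.keys p \<subseteq> K"
  shows "pm_eval \<phi> p = (\<Sum>k\<in>K. Poly_Mapping.lookup p k * \<phi> k)"
  unfolding pm_eval_def
  by (rule sum.mono_neutral_left) (use assms in \<open>auto simp: in_keys_iff\<close>)

lemma pm_eval_zero [simp]: "pm_eval \<phi> 0 = 0"
  by (simp add: pm_eval_def)

lemma pm_eval_single [simp]: "pm_eval \<phi> (Poly_Mapping.single k c) = c * \<phi> k"
  using pm_eval_superset[of "{k}" "Poly_Mapping.single k c" \<phi>] by simp

lemma pm_eval_add: "pm_eval \<phi> (p + q) = pm_eval \<phi> p + pm_eval \<phi> q"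
proof -
  let ?K = "Poly_Mapping.keys p \<union> Poly_Mapping.keys q"
  have "pm_eval \<phi> (p + q) = (\<Sum>k\<in>?K. Poly_Mapping.lookup (p + q) k * \<phi> k)"
    using Poly_Mapping.keys_add[of p q] by (intro pm_eval_superset) auto
  also have "\<dots> = pm_eval \<phi> p + pm_eval \<phi> q"
    by (simp add: pm_eval_superset[of ?K] lookup_add algebra_simps sum.distrib)
  finally show ?thesis .
qed

lemma pm_eval_diff: "pm_eval \<phi> (p - q) = pm_eval \<phi> p - pm_eval \<phi> q"
  using pm_eval_add[of \<phi> "p - q" q] by simp

lemma pm_eval_sum: "pm_eval \<phi> (\<Sum>i\<in>I. p i) = (\<Sum>i\<in>I. pm_eval \<phi> (p i))"
  by (induction I rule: infinite_finite_induct) (simp_all add: pm_eval_add)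

lemma pm_eval_scale: "pm_eval \<phi> (Poly_Mapping.map ((*) c) p) = c * pm_eval \<phi> p"
proof -
  have "pm_eval \<phi> (Poly_Mapping.map ((*) c) p) =
      (\<Sum>k\<in>Poly_Mapping.keys p. Poly_Mapping.lookup (Poly_Mapping.map ((*) c) p) k * \<phi> k)"
    by (rule pm_eval_superset) (auto simp: in_keys_iff Poly_Mapping.map.rep_eq when_def)
  also have "\<dots> = c * pm_eval \<phi> p"
    by (auto simp: pm_eval_def sum_distrib_left Poly_Mapping.map.rep_eq when_def in_keys_iff intro!: sum.cong)
  finally show ?thesis .
qed

lemma pm_sum_single: "(\<Sum>k\<in>Poly_Mapping.keys p. Poly_Mapping.single k (Poly_Mapping.lookup p k)) = p"
  by (rule poly_mapping_eqI)
    (auto simp: lookup_sum lookup_single when_def in_keys_iff sum.delta' if_distrib cong: if_cong)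

lemma pm_eval_mult: "pm_eval \<phi> (r * p) = pm_eval (\<lambda>c. pm_eval (\<lambda>b. \<phi> (c + b)) p) r"
proof -
  have 1: "pm_eval \<phi> (Poly_Mapping.single c x * Poly_Mapping.single b y) = x * y * \<phi> (c + b)" for c b x y
    by (simp add: mult_single)
  have 2: "pm_eval \<phi> (Poly_Mapping.single c x * p) = x * pm_eval (\<lambda>b. \<phi> (c + b)) p" for c x
  proof -
    have "pm_eval \<phi> (Poly_Mapping.single c x * p) = pm_eval \<phi> (Poly_Mapping.single c x *
        (\<Sum>k\<in>Poly_Mapping.keys p. Poly_Mapping.single k (Poly_Mapping.lookup p k)))"
      by (simp only: pm_sum_single)
    also have "\<dots> = x * pm_eval (\<lambda>b. \<phi> (c + b)) p"
      by (simp add: sum_distrib_left pm_eval_sum 1 mult.assoc) (simp add: pm_eval_def sum_distrib_left)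
    finally show ?thesis .
  qed
  have "pm_eval \<phi> (r * p) = pm_eval \<phi>
        ((\<Sum>k\<in>Poly_Mapping.keys r. Poly_Mapping.single k (Poly_Mapping.lookup r k)) * p)"
      by (simp only: pm_sum_single)
  also have "\<dots> = pm_eval (\<lambda>c. pm_eval (\<lambda>b. \<phi> (c + b)) p) r"
    by (simp add: sum_distrib_right pm_eval_sum 2) (simp add: pm_eval_def)
  finally show ?thesis .
qed

section \<open>Toric ideals and linear functionals that vanish on them\<close>

definition ivec :: "nat ^ 'n \<Rightarrow> int ^ 'n" where
  "ivec u = (\<chi> j. int (u $ j))"

lemma ivec_nth [simp]: "ivec u $ j = int (u $ j)"
  by (simp add: ivec_def)

lemma ivec_add: "ivec (u + u') = ivec u + ivec u'"
  by (simp add: vec_eq_iff)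

lemma ideal_gen_induct [consumes 1, case_names zero add mult]:
  assumes "p \<in> ideal_gen S" "P 0" "\<And>p q. P p \<Longrightarrow> P q \<Longrightarrow> P (p + q)"
    and "\<And>r s. s \<in> S \<Longrightarrow> P (r * s)"
  shows "P p"
proof -
  interpret M: module "(*) :: 'a \<Rightarrow> 'a \<Rightarrow> 'a" by (rule module_ring_mult)
  show ?thesis
    using assms(1) unfolding ideal_gen_def
  proof (induction rule: M.span_induct_alt)
    case base then show ?case by (rule assms(2))
  next
    case (step c x y) then show ?case using assms(3,4) by blast
  qed
qed

lemma ideal_gen_base: "s \<in> S \<Longrightarrow> s \<in> ideal_gen S"
  unfolding ideal_gen_def by (rule module.span_base[OF module_ring_mult])

lemma ideal_gen_mult: "s \<in> ideal_gen S \<Longrightarrow> r * s \<in> ideal_gen S"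
  unfolding ideal_gen_def by (rule module.span_scale[OF module_ring_mult])

text \<open>Multiplying a binomial by a monomial moves both exponents by the same vector and so
  keeps them in one fibre of \<open>A\<close>; hence all multiples of the generators are killed.
  This is used with derivatives of a solution and with the indicator of a fibre.\<close>

lemma toric_ideal_pm_eval:
  assumes p: "p \<in> toric_ideal A" and inv: "\<And>u u'. A *v ivec u = A *v ivec u' \<Longrightarrow> \<phi> u = \<phi> u'"
  shows "pm_eval \<phi> p = 0"
  using p unfolding toric_ideal_def
proof (induction rule: ideal_gen_induct)
  case (mult r s)
  then obtain u u' where s: "s = dmonom u - dmonom u'" and u: "A *v ivec u = A *v ivec u'"
    by (auto simp: ivec_def)
  have "\<phi> (c + u) = \<phi> (c + u')" for c
    by (rule inv) (simp add: ivec_add matrix_vector_right_distrib u)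
  then show ?case
    by (simp add: s pm_eval_mult pm_eval_diff dmonom_def) (simp add: pm_eval_def)
qed (simp_all add: pm_eval_add)

lemma toric_ideal_binomial:
  "A *v ivec u = A *v ivec u' \<Longrightarrow> dmonom u - dmonom u' \<in> toric_ideal A"
  unfolding toric_ideal_def by (rule ideal_gen_base) (auto simp: ivec_def)

section \<open>Iterated partial derivatives and their independence of the order\<close>

lemma holomorphic_sev_on_foldr_cpartial:
  "holomorphic_sev_on f U \<Longrightarrow> open U \<Longrightarrow> holomorphic_sev_on (foldr cpartial is f) U"
  by (induction "is") (auto intro: holomorphic_sev_on_cpartial)

lemma foldr_cpartial_remove1:
  assumes f: "holomorphic_sev_on f U" and U: "open U"
  shows "i \<in> set is \<Longrightarrow> x \<in> U \<Longrightarrow>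
    foldr cpartial is f x = cpartial i (foldr cpartial (remove1 i is) f) x"
proof (induction "is" arbitrary: x)
  case (Cons j js)
  show ?case
  proof (cases "i = j")
    case False
    then have i: "i \<in> set js" using Cons by auto
    have "cpartial j (foldr cpartial js f) x = cpartial j (cpartial i (foldr cpartial (remove1 i js) f)) x"
      by (rule cpartial_cong[OF U Cons.prems(2)])
        (auto intro: Cons.IH[OF i] holomorphic_sev_on_foldr_cpartial f U)
    also have "\<dots> = cpartial i (cpartial j (foldr cpartial (remove1 i js) f)) x"
      by (rule cpartial_commute[OF holomorphic_sev_on_foldr_cpartial[OF f U] U Cons.prems(2)])
    finally show ?thesis using False by simp
  qed simp
qed simp

lemma foldr_cpartial_perm:
  assumes f: "holomorphic_sev_on f U" and U: "open U"
  shows "mset is = mset js \<Longrightarrow> x \<in> U \<Longrightarrow> foldr cpartial is f x = foldr cpartial js f x"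
proof (induction "is" arbitrary: js x)
  case (Cons i "is")
  then have i: "i \<in> set js" by (metis list.set_intros(1) set_mset_mset)
  have m: "mset is = mset (remove1 i js)" using Cons.prems(1)[symmetric] by simp
  have "foldr cpartial (i # is) f x = cpartial i (foldr cpartial (remove1 i js) f) x"
    using cpartial_cong[OF U Cons.prems(2), of "foldr cpartial is f" "foldr cpartial (remove1 i js) f" i]
      Cons.IH[OF m] holomorphic_sev_on_foldr_cpartial[OF f U] by simp
  then show ?case using foldr_cpartial_remove1[OF f U i Cons.prems(2)] by simp
qed simp

text \<open>Without such a list the \<open>SOME\<close> in \<open>multi_cpartial\<close> would say
  nothing about the value.\<close>

lemma ex_list_count:
  fixes b :: "nat ^ 'n::finite"
  shows "\<exists>is. \<forall>i. count_list is i = b $ i"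
proof -
  obtain "is" where "mset is = (\<Sum>i\<in>UNIV. replicate_mset (b $ i) i)"
    using ex_mset by blast
  then have "count (mset is) j = b $ j" for j
    by (simp add: count_sum)
  then have "count_list is j = b $ j" for j
    by (simp add: count_mset)
  then show ?thesis by blast
qed

lemma multi_cpartial_eq_foldr:
  assumes f: "holomorphic_sev_on f U" and U: "open U" and x: "x \<in> U"
    and "is": "\<And>i. count_list is i = b $ i"
  shows "multi_cpartial b f x = foldr cpartial is f x"
  unfolding multi_cpartial_def
proof (rule foldr_cpartial_perm[OF f U _ x])
  have "\<forall>i. count_list (SOME is. \<forall>i. count_list is i = b $ i) i = b $ i"
    using ex_list_count by (rule someI_ex)
  then show "mset (SOME is. \<forall>i. count_list is i = b $ i) = mset is"
    using "is" by (simp add: multiset_eq_iff count_mset)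
qed

lemma holomorphic_sev_on_multi_cpartial:
  "holomorphic_sev_on f U \<Longrightarrow> open U \<Longrightarrow> holomorphic_sev_on (multi_cpartial b f) U"
  unfolding multi_cpartial_def by (rule holomorphic_sev_on_foldr_cpartial)

lemma multi_cpartial_zero:
  assumes "holomorphic_sev_on f U" "open U" "x \<in> U"
  shows "multi_cpartial 0 f x = f x"
  using multi_cpartial_eq_foldr[OF assms, of "[]" 0] by simp

text \<open>The extra index is put at the front of the list for the outer derivative and at its end
  for the inner one.\<close>

lemma multi_cpartial_add_axis:
  assumes f: "holomorphic_sev_on f U" and U: "open U" and x: "x \<in> U"
  shows "multi_cpartial (b + axis i 1) f x = cpartial i (multi_cpartial b f) x" (is ?th1)
    and "multi_cpartial (b + axis i 1) f x = multi_cpartial b (cpartial i f) x" (is ?th2)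
proof -
  obtain "is" where "is": "\<And>i. count_list is i = b $ i" using ex_list_count by blast
  have "multi_cpartial (b + axis i 1) f x = foldr cpartial (i # is) f x"
    by (rule multi_cpartial_eq_foldr[OF f U x]) (simp add: "is" axis_def)
  also have "\<dots> = cpartial i (multi_cpartial b f) x"
    using cpartial_cong[OF U x, of "multi_cpartial b f" "foldr cpartial is f" i]
      multi_cpartial_eq_foldr[OF f U, of _ "is" b] "is" holomorphic_sev_on_multi_cpartial[OF f U]
    by simp
  finally show ?th1 .
  have "multi_cpartial (b + axis i 1) f x = foldr cpartial (is @ [i]) f x"
    by (rule multi_cpartial_eq_foldr[OF f U x]) (simp add: "is" axis_def)
  also have "\<dots> = multi_cpartial b (cpartial i f) x"
    using multi_cpartial_eq_foldr[OF holomorphic_sev_on_cpartial[OF f U] U x "is"] by simp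
  finally show ?th2 .
qed

lemma multi_cpartial_axis:
  assumes "holomorphic_sev_on f U" "open U" "x \<in> U"
  shows "multi_cpartial (axis i 1) f x = cpartial i f x"
  using multi_cpartial_eq_foldr[OF assms, of "[i]" "axis i 1"] by (simp add: axis_def)

lemma multi_cpartial_cong:
  assumes f: "holomorphic_sev_on f U" and U: "open U" and x: "x \<in> U" and eq: "\<And>y. y \<in> U \<Longrightarrow> f y = g y"
  shows "multi_cpartial b f x = multi_cpartial b g x"
proof -
  have "foldr cpartial is f x = foldr cpartial is g x" if "x \<in> U" for x "is"
    using that
  proof (induction "is" arbitrary: x)
    case (Cons i "is")
    then show ?case
      using cpartial_cong[OF U, of x "foldr cpartial is f" "foldr cpartial is g" i]
        holomorphic_sev_on_foldr_cpartial[OF f U] by simp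
  qed (simp add: eq)
  then show ?thesis using x unfolding multi_cpartial_def by blast
qed

section \<open>Solutions of hypergeometric systems\<close>

lemma weyl_apply_eq_pm_eval:
  "weyl_apply P f x = pm_eval (\<lambda>(a, b). (\<Prod>j\<in>UNIV. x $ j ^ (a $ j)) * multi_cpartial b f x) P"
  unfolding weyl_apply_def pm_eval_def by (intro sum.cong) (auto simp: mult.assoc)

lemma pm_eval_weyl_of_dpoly: "pm_eval \<phi> (weyl_of_dpoly p) = pm_eval (\<lambda>b. \<phi> (0, b)) p"
  by (simp add: weyl_of_dpoly_def pm_eval_sum) (simp add: pm_eval_def)

lemma prod_power_axis: "(\<Prod>j\<in>UNIV. (x::complex ^ 'n::finite) $ j ^ (axis i 1 $ j)) = x $ i"
proof -
  have "(\<Prod>j\<in>UNIV. x $ j ^ (axis i 1 $ j)) = (\<Prod>j\<in>UNIV. if j = i then x $ j else 1)"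
    by (rule prod.cong) (auto simp: axis_def)
  then show ?thesis by simp
qed

lemma prod_power_add:
  "(\<Prod>j\<in>UNIV. (x::complex ^ 'n::finite) $ j ^ ((a + b) $ j)) =
    (\<Prod>j\<in>UNIV. x $ j ^ (a $ j)) * (\<Prod>j\<in>UNIV. x $ j ^ (b $ j))"
  by (simp add: power_add prod.distrib)

text \<open>Subtraction of exponents is truncated; where this matters, that is for
  \<open>a $ i = 0\<close>, the coefficient makes both sides vanish.\<close>

lemma prod_power_diff_axis:
  fixes x :: "complex ^ 'n::finite"
  assumes "x $ i \<noteq> 0"
  shows "of_nat (a $ i) * (\<Prod>j\<in>UNIV. x $ j ^ ((a - axis i 1) $ j)) =
    of_nat (a $ i) / x $ i * (\<Prod>j\<in>UNIV. x $ j ^ (a $ j))"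
proof (cases "a $ i = 0")
  case False
  then have "a = (a - axis i 1) + axis i 1"
    by (auto simp: vec_eq_iff axis_def)
  then have "(\<Prod>j\<in>UNIV. x $ j ^ (a $ j)) = (\<Prod>j\<in>UNIV. x $ j ^ ((a - axis i 1) $ j)) * x $ i"
    using prod_power_add[of x "a - axis i 1" "axis i 1"] prod_power_axis[of x i] by metis
  then show ?thesis using assms by simp
qed simp

lemma weyl_apply_weyl_x: "weyl_apply (weyl_x i P) f x = x $ i * weyl_apply P f x"
  unfolding weyl_apply_eq_pm_eval weyl_x_def pm_eval_sum
  unfolding pm_eval_def[of _ P] sum_distrib_left
  by (intro sum.cong) (auto simp: power_add prod.distrib prod_power_axis[simplified])

lemma has_cgradient_prod_power:
  fixes x :: "complex ^ 'n::finite"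
  assumes "\<And>j. x $ j \<noteq> 0"
  shows "has_cgradient (\<lambda>y. \<Prod>j\<in>UNIV. y $ j ^ (a $ j))
    (\<lambda>i. of_nat (a $ i) / x $ i * (\<Prod>j\<in>UNIV. x $ j ^ (a $ j))) x"
proof -
  have "has_cgradient (\<lambda>y. y $ j ^ k) (\<lambda>i. (if i = j then of_nat k / x $ i else 0) * x $ j ^ k) x" for j k
  proof -
    have "has_cgradient (\<lambda>y. y $ j ^ k) (\<lambda>i. (of_nat k * x $ j ^ (k - 1)) * (if i = j then 1 else 0)) x"
      by (rule has_cgradient_compose[OF has_cgradient_nth]) (auto intro!: derivative_eq_intros)
    moreover have "(\<lambda>i. (of_nat k * x $ j ^ (k - 1)) * (if i = j then 1 else 0)) =
        (\<lambda>i. (if i = j then of_nat k / x $ i else 0) * x $ j ^ k)"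
      using assms[of j] by (cases k) (auto simp: fun_eq_iff field_simps)
    ultimately show ?thesis by simp
  qed
  then have "has_cgradient (\<lambda>y. \<Prod>j\<in>UNIV. y $ j ^ (a $ j))
      (\<lambda>i. (\<Sum>j\<in>UNIV. if i = j then of_nat (a $ j) / x $ i else 0) * (\<Prod>j\<in>UNIV. x $ j ^ (a $ j))) x"
    by (intro has_cgradient_prod) auto
  then show ?thesis by simp
qed

text \<open>The commutation rule built into \<open>weyl_d\<close> is the Leibniz rule for the
  product of a monomial with a derivative of \<open>f\<close>.\<close>

lemma has_cgradient_weyl_apply:
  assumes f: "holomorphic_sev_on f U" and U: "open U" and x: "x \<in> U" and x0: "\<And>j. x $ j \<noteq> 0"
  shows "has_cgradient (weyl_apply P f) (\<lambda>i. weyl_apply (weyl_d i P) f x) x"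
proof -
  let ?m = "\<lambda>a (x::complex^'a). \<Prod>j\<in>UNIV. x $ j ^ (a $ j)"
  have "has_cgradient (\<lambda>y. case k of (a, b) \<Rightarrow> Poly_Mapping.lookup P (a, b) * (?m a y * multi_cpartial b f y))
    (\<lambda>i. case k of (a, b) \<Rightarrow> Poly_Mapping.lookup P (a, b) *
      (?m a x * cpartial i (multi_cpartial b f) x + (of_nat (a $ i) / x $ i * ?m a x) * multi_cpartial b f x)) x" for k
    unfolding case_prod_unfold
    by (intro has_cgradient_cmult has_cgradient_mult has_cgradient_prod_power x0
        holomorphic_sev_on_cgradient[OF holomorphic_sev_on_multi_cpartial[OF f U] x])
  from has_cgradient_sum[where K = "Poly_Mapping.keys P", OF this]
  have "has_cgradient (weyl_apply P f)
    (\<lambda>i. \<Sum>k\<in>Poly_Mapping.keys P. case k of (a, b) \<Rightarrow> Poly_Mapping.lookup P (a, b) *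
      (?m a x * cpartial i (multi_cpartial b f) x + (of_nat (a $ i) / x $ i * ?m a x) * multi_cpartial b f x)) x"
    unfolding weyl_apply_def mult.assoc .
  moreover have "(\<Sum>k\<in>Poly_Mapping.keys P. case k of (a, b) \<Rightarrow> Poly_Mapping.lookup P (a, b) *
      (?m a x * cpartial i (multi_cpartial b f) x + (of_nat (a $ i) / x $ i * ?m a x) * multi_cpartial b f x))
      = weyl_apply (weyl_d i P) f x" for i
    unfolding weyl_apply_eq_pm_eval weyl_d_def pm_eval_sum
  proof (rule sum.cong)
    fix k assume "k \<in> Poly_Mapping.keys P"
    obtain a b where k: "k = (a, b)" by (cases k)
    have "of_nat (a $ i) * Poly_Mapping.lookup P (a, b) * (?m (a - axis i 1) x * multi_cpartial b f x) =
      Poly_Mapping.lookup P (a, b) * multi_cpartial b f x * (of_nat (a $ i) * ?m (a - axis i 1) x)"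
      by (simp only: mult_ac)
    then show "(case k of (a, b) \<Rightarrow> Poly_Mapping.lookup P (a, b) *
      (?m a x * cpartial i (multi_cpartial b f) x + (of_nat (a $ i) / x $ i * ?m a x) * multi_cpartial b f x)) =
      pm_eval (\<lambda>(a, b). ?m a x * multi_cpartial b f x) (case k of (a, b) \<Rightarrow>
       Poly_Mapping.single (a, b + axis i 1) (Poly_Mapping.lookup P (a, b)) +
       Poly_Mapping.single (a - axis i 1, b) (of_nat (a $ i) * Poly_Mapping.lookup P (a, b)))"
      unfolding k prod.case pm_eval_add pm_eval_single
        multi_cpartial_add_axis(1)[OF f U x] prod_power_diff_axis[OF x0]
      by (simp add: algebra_simps)
  qed simp
  ultimately show ?thesis by simp
qed

lemma weyl_apply_euler_op:
  assumes "holomorphic_sev_on f U" "open U" "x \<in> U"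
  shows "weyl_apply (euler_op A \<gamma> i) f x =
    (\<Sum>j\<in>UNIV. of_int (A $ i $ j) * (x $ j * cpartial j f x)) - \<gamma> $ i * f x"
  unfolding weyl_apply_eq_pm_eval euler_op_def pm_eval_diff pm_eval_sum
  using multi_cpartial_axis[OF assms] multi_cpartial_zero[OF assms]
  by (simp add: prod_power_axis[simplified])

lemma weyl_apply_weyl_of_dpoly:
  "weyl_apply (weyl_of_dpoly p) f x = pm_eval (\<lambda>b. multi_cpartial b f x) p"
  unfolding weyl_apply_eq_pm_eval pm_eval_weyl_of_dpoly by simp

section \<open>Reduction of the system to binomial and Euler equations\<close>

definition toric_solution :: "(complex ^ 'n) set \<Rightarrow> int ^ 'n::finite ^ 'd::finite \<Rightarrow>
    (complex ^ 'n \<Rightarrow> complex) \<Rightarrow> bool" where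
  "toric_solution U A f \<longleftrightarrow> (\<forall>u u'. A *v ivec u = A *v ivec u' \<longrightarrow>
     (\<forall>x\<in>U. multi_cpartial u f x = multi_cpartial u' f x))"

definition euler_solution :: "(complex ^ 'n) set \<Rightarrow> int ^ 'n::finite ^ 'd::finite \<Rightarrow> complex ^ 'd \<Rightarrow>
    (complex ^ 'n \<Rightarrow> complex) \<Rightarrow> bool" where
  "euler_solution U A \<gamma> f \<longleftrightarrow> (\<forall>i. \<forall>x\<in>U.
     (\<Sum>j\<in>UNIV. of_int (A $ i $ j) * (x $ j * cpartial j f x)) = \<gamma> $ i * f x)"

text \<open>The operators killing \<open>f\<close> on \<open>U\<close> are closed under all
  operations that build the left ideal, so the generators suffice; those from the toric ideal are in
  turn controlled by its binomials.\<close>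

lemma solutions_iff:
  fixes A :: "int ^ 'n::finite ^ 'd::finite"
  assumes U: "open U" and U0: "\<And>x j. x \<in> U \<Longrightarrow> x $ j \<noteq> 0"
  shows "f \<in> solutions U (hypergeometric_ideal A \<gamma>) \<longleftrightarrow>
    holomorphic_sev_on f U \<and> (\<forall>x. x \<notin> U \<longrightarrow> f x = 0) \<and> toric_solution U A f \<and> euler_solution U A \<gamma> f"
    (is "?L \<longleftrightarrow> ?R")
proof
  assume L: ?L
  then have f: "holomorphic_sev_on f U" and z: "\<forall>x. x \<notin> U \<longrightarrow> f x = 0"
    and P: "\<And>P x. P \<in> hypergeometric_ideal A \<gamma> \<Longrightarrow> x \<in> U \<Longrightarrow> weyl_apply P f x = 0"
    by (auto simp: solutions_def)
  have "multi_cpartial u f x = multi_cpartial u' f x" if u: "A *v ivec u = A *v ivec u'" and x: "x \<in> U" for u u' x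
  proof -
    have "weyl_of_dpoly (dmonom u - dmonom u') \<in> hypergeometric_ideal A \<gamma>"
      unfolding hypergeometric_ideal_def
      by (rule weyl_left_ideal.gen) (use toric_ideal_binomial[OF u] in blast)
    from P[OF this x] show ?thesis
      unfolding weyl_apply_weyl_of_dpoly by (simp add: pm_eval_diff dmonom_def)
  qed
  moreover have "(\<Sum>j\<in>UNIV. of_int (A $ i $ j) * (x $ j * cpartial j f x)) = \<gamma> $ i * f x"
    if x: "x \<in> U" for i x
  proof -
    have "euler_op A \<gamma> i \<in> hypergeometric_ideal A \<gamma>"
      unfolding hypergeometric_ideal_def by (rule weyl_left_ideal.gen) blast
    from P[OF this x] show ?thesis unfolding weyl_apply_euler_op[OF f U x] by simp
  qed
  ultimately show ?R using f z unfolding toric_solution_def euler_solution_def by blast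
next
  assume R: ?R
  then have f: "holomorphic_sev_on f U" and t: "toric_solution U A f" and e: "euler_solution U A \<gamma> f"
    by auto
  have "\<forall>x\<in>U. weyl_apply P f x = 0" if "P \<in> hypergeometric_ideal A \<gamma>" for P
    using that unfolding hypergeometric_ideal_def
  proof (induction rule: weyl_left_ideal.induct)
    case (gen P)
    then show ?case
    proof
      assume "P \<in> weyl_of_dpoly ` toric_ideal A"
      then obtain p where p: "p \<in> toric_ideal A" "P = weyl_of_dpoly p" by blast
      have "pm_eval (\<lambda>b. multi_cpartial b f x) p = 0" if "x \<in> U" for x
        using t that unfolding toric_solution_def by (intro toric_ideal_pm_eval[OF p(1)]) blast
      then show ?thesis by (simp add: p(2) weyl_apply_weyl_of_dpoly)
    next
      assume "P \<in> range (euler_op A \<gamma>)"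
      then show ?thesis using e by (auto simp: weyl_apply_euler_op[OF f U] euler_solution_def)
    qed
  next
    case (mult_x P i)
    then show ?case by (simp add: weyl_apply_weyl_x)
  next
    case (mult_d P i)
    \<comment> \<open>\<open>P\<close> applied to \<open>f\<close> vanishes on the whole open set
      \<open>U\<close>, so its gradient is zero there; uniqueness of the gradient settles
      \<open>weyl_d i P\<close>.\<close>
    show ?case
    proof
      fix x assume x: "x \<in> U"
      have "has_cgradient (weyl_apply P f) (\<lambda>i. weyl_apply (weyl_d i P) f x) x"
        by (rule has_cgradient_weyl_apply[OF f U x U0[OF x]])
      moreover have "has_cgradient (weyl_apply P f) (\<lambda>i. 0) x"
        using has_cgradient_cong[OF U x, of "weyl_apply P f" "\<lambda>_. 0" "\<lambda>_. 0"] mult_d.IH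
        by (simp add: has_cgradient_const)
      ultimately show "weyl_apply (weyl_d i P) f x = 0"
        using has_cgradient_unique by metis
    qed
  qed (simp_all add: weyl_apply_eq_pm_eval pm_eval_add pm_eval_scale)
  then show ?L using R by (auto simp: solutions_def)
qed

text \<open>Differentiating the Euler equation in direction \<open>k\<close> produces one extra term
  from the factor \<open>x $ k\<close>, and this lowers \<open>\<gamma>\<close> by the
  \<open>k\<close>-th column of \<open>A\<close>.\<close>

lemma euler_solution_cpartial:
  fixes A :: "int ^ 'n::finite ^ 'd::finite"
  assumes f: "holomorphic_sev_on f U" and U: "open U" and e: "euler_solution U A \<gamma> f"
    and \<gamma>': "\<And>i. \<gamma>' $ i = \<gamma> $ i - of_int (A $ i $ k)"
  shows "euler_solution U A \<gamma>' (cpartial k f)"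
  unfolding euler_solution_def
proof (intro allI ballI)
  fix i x assume x: "x \<in> U"
  define E where "E y = (\<Sum>j\<in>UNIV. of_int (A $ i $ j) * (y $ j * cpartial j f y))" for y
  have g1: "has_cgradient E (\<lambda>l. \<Sum>j\<in>UNIV. of_int (A $ i $ j) *
      (x $ j * cpartial l (cpartial j f) x + (if l = j then 1 else 0) * cpartial j f x)) x"
    unfolding E_def
    by (intro has_cgradient_sum has_cgradient_cmult has_cgradient_mult has_cgradient_nth
        holomorphic_sev_on_cgradient[OF holomorphic_sev_on_cpartial[OF f U] x])
  have g2: "has_cgradient E (\<lambda>l. \<gamma> $ i * cpartial l f x) x"
    using has_cgradient_cong[OF U x, of E "\<lambda>y. \<gamma> $ i * f y"]
      has_cgradient_cmult[OF holomorphic_sev_on_cgradient[OF f x]] e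
    by (simp add: E_def euler_solution_def)
  have "(\<Sum>j\<in>UNIV. of_int (A $ i $ j) *
      (x $ j * cpartial k (cpartial j f) x + (if k = j then 1 else 0) * cpartial j f x)) =
      \<gamma> $ i * cpartial k f x"
    using fun_cong[OF has_cgradient_unique[OF g1 g2], of k] .
  moreover have "(\<Sum>j\<in>UNIV. of_int (A $ i $ j) *
      (x $ j * cpartial k (cpartial j f) x + (if k = j then 1 else 0) * cpartial j f x)) =
    (\<Sum>j\<in>UNIV. of_int (A $ i $ j) * (x $ j * cpartial j (cpartial k f) x)) +
    of_int (A $ i $ k) * cpartial k f x"
    by (simp add: ring_distribs sum.distrib cpartial_commute[OF f U x, of k] if_distrib[of "\<lambda>z. _ * z"]
        if_distrib[of "\<lambda>z. z * _"] cong: if_cong)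
  ultimately show "(\<Sum>j\<in>UNIV. of_int (A $ i $ j) * (x $ j * cpartial j (cpartial k f) x)) =
      \<gamma>' $ i * cpartial k f x"
    by (simp add: \<gamma>' algebra_simps)
qed

lemma toric_solution_cpartial:
  fixes A :: "int ^ 'n::finite ^ 'd::finite"
  assumes f: "holomorphic_sev_on f U" and U: "open U" and t: "toric_solution U A f"
  shows "toric_solution U A (cpartial k f)"
  unfolding toric_solution_def
proof (intro allI impI ballI)
  fix u u' x assume "A *v ivec u = A *v ivec u'" and x: "x \<in> U"
  then have "A *v ivec (u + axis k 1) = A *v ivec (u' + axis k 1)"
    by (simp add: ivec_add matrix_vector_right_distrib)
  then show "multi_cpartial u (cpartial k f) x = multi_cpartial u' (cpartial k f) x"
    using t x multi_cpartial_add_axis(2)[OF f U x, of _ k] unfolding toric_solution_def by metis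
qed

lemma cpartial_on_linear_map_between:
  fixes A :: "int ^ 'n::finite ^ 'd::finite"
  assumes U: "open U" and U0: "\<And>x j. x \<in> U \<Longrightarrow> x $ j \<noteq> 0"
    and \<gamma>': "\<And>i. \<gamma>' $ i = \<gamma> $ i - of_int (A $ i $ k)"
  shows "linear_map_between (solutions U (hypergeometric_ideal A \<gamma>))
    (solutions U (hypergeometric_ideal A \<gamma>')) (cpartial_on U k)"
proof -
  have iff: "f \<in> solutions U (hypergeometric_ideal A \<gamma>) \<longleftrightarrow> holomorphic_sev_on f U \<and>
      (\<forall>x. x \<notin> U \<longrightarrow> f x = 0) \<and> toric_solution U A f \<and> euler_solution U A \<gamma> f" for f \<gamma>
    by (rule solutions_iff[OF U U0])
  have "cpartial_on U k f \<in> solutions U (hypergeometric_ideal A \<gamma>')"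
    if "f \<in> solutions U (hypergeometric_ideal A \<gamma>)" for f
  proof -
    have f: "holomorphic_sev_on f U" and t: "toric_solution U A f" and e: "euler_solution U A \<gamma> f"
      using that unfolding iff by auto
    have hol: "holomorphic_sev_on (cpartial k f) U" by (rule holomorphic_sev_on_cpartial[OF f U])
    have eq: "cpartial k f y = cpartial_on U k f y" if "y \<in> U" for y
      using that by (simp add: cpartial_on_def)
    have "toric_solution U A (cpartial_on U k f)"
      unfolding toric_solution_def
    proof (intro allI impI ballI)
      fix u u' x assume u: "A *v ivec u = A *v ivec u'" and x: "x \<in> U"
      have "multi_cpartial b (cpartial k f) x = multi_cpartial b (cpartial_on U k f) x" for b
        by (rule multi_cpartial_cong[OF hol U x eq])
      then show "multi_cpartial u (cpartial_on U k f) x = multi_cpartial u' (cpartial_on U k f) x"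
        using toric_solution_cpartial[OF f U t, of k] u x unfolding toric_solution_def by metis
    qed
    moreover have "euler_solution U A \<gamma>' (cpartial_on U k f)"
      using euler_solution_cpartial[OF f U e \<gamma>'] cpartial_cong[OF U _ eq hol] eq
      by (simp add: euler_solution_def)
    moreover have "holomorphic_sev_on (cpartial_on U k f) U"
      using holomorphic_sev_on_cong[OF U eq hol] .
    ultimately show ?thesis unfolding iff by (auto simp: cpartial_on_def)
  qed
  moreover have "cpartial_on U k (f + g) = cpartial_on U k f + cpartial_on U k g"
    if "holomorphic_sev_on f U" "holomorphic_sev_on g U" for f g
    using has_cgradient_cpartial(2)[OF has_cgradient_add[OF holomorphic_sev_on_cgradient[OF that(1)]
          holomorphic_sev_on_cgradient[OF that(2)]]]
    by (auto simp: cpartial_on_def fun_eq_iff plus_fun_def)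
  moreover have "cpartial_on U k (fun_scale c f) = fun_scale c (cpartial_on U k f)"
    if "holomorphic_sev_on f U" for f c
    using has_cgradient_cpartial(2)[OF has_cgradient_cmult[OF holomorphic_sev_on_cgradient[OF that(1)]]]
    by (auto simp: cpartial_on_def fun_eq_iff fun_scale_def)
  ultimately show ?thesis
    unfolding linear_map_between_def by (auto simp: solutions_def)
qed

section \<open>Monomials with complex exponents\<close>

lemma log_branches_nonzero: "log_branches U L \<Longrightarrow> x \<in> U \<Longrightarrow> x $ j \<noteq> 0"
  unfolding log_branches_def by (metis exp_not_eq_zero)

text \<open>A branch is only assumed continuous. Near \<open>x\<close> it stays so close to its
  value there that it must equal \<open>L i x + Ln (y $ i / x $ i)\<close>, which is
  differentiable.\<close>

lemma has_cgradient_log_branch: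
  assumes L: "log_branches U L" and U: "open U" and x: "x \<in> U"
  shows "has_cgradient (L i) (\<lambda>j. (if j = i then 1 / x $ i else 0)) x"
proof -
  have cont: "continuous_on U (L i)" and ex: "\<And>y. y \<in> U \<Longrightarrow> exp (L i y) = y $ i"
    using L by (auto simp: log_branches_def)
  have x0: "x $ i \<noteq> 0" using log_branches_nonzero[OF L x] .
  \<comment> \<open>Radius 1 keeps the imaginary part of \<open>L i y - L i x\<close> below pi in
    absolute value, where \<open>Ln\<close> inverts \<open>exp\<close>.\<close>
  define V where "V = U \<inter> L i -` ball (L i x) 1"
  have V: "open V" "x \<in> V"
    using continuous_open_preimage[OF cont U open_ball] x by (auto simp: V_def)
  have eq: "L i x + Ln (y $ i / x $ i) = L i y" if "y \<in> V" for y
  proof -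
    have "norm (L i y - L i x) < 1" using that by (simp add: V_def dist_norm norm_minus_commute)
    then have "\<bar>Im (L i y - L i x)\<bar> < pi"
      using abs_Im_le_cmod[of "L i y - L i x"] pi_gt3 by linarith
    then have "Ln (exp (L i y - L i x)) = L i y - L i x" by (intro Ln_exp) auto
    moreover have "exp (L i y - L i x) = y $ i / x $ i"
      using that ex x by (simp add: exp_diff V_def)
    ultimately show ?thesis by simp
  qed
  have "has_cgradient (\<lambda>y. L i x + Ln (y $ i / x $ i)) (\<lambda>j. (1 / x $ i) * (if j = i then 1 else 0)) x"
    by (rule has_cgradient_compose[OF has_cgradient_nth, where g = "\<lambda>z. L i x + Ln (z / x $ i)"])
      (use x0 in \<open>auto intro!: derivative_eq_intros simp: field_simps\<close>)
  then show ?thesis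
    using has_cgradient_cong[OF V eq] by (simp add: if_distrib[of "\<lambda>z. _ * z"] cong: if_cong)
qed

lemma cmonomial_on_diff_axis:
  assumes L: "log_branches U L" and x: "x \<in> U"
  shows "cmonomial_on U L (u - axis j 1) x = cmonomial_on U L u x / x $ j"
proof -
  have "(\<Prod>i\<in>UNIV. exp ((u - axis j 1) $ i * L i x)) =
      (\<Prod>i\<in>UNIV. exp (u $ i * L i x) * (if i = j then inverse (x $ j) else 1))"
    using L x log_branches_nonzero[OF L x, of j]
    by (intro prod.cong) (auto simp: axis_def log_branches_def left_diff_distrib exp_diff field_simps)
  then show ?thesis using x by (simp add: cmonomial_on_def prod.distrib field_simps)
qed

lemma has_cgradient_cmonomial_on:
  assumes L: "log_branches U L" and U: "open U" and x: "x \<in> U"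
  shows "has_cgradient (cmonomial_on U L u) (\<lambda>j. u $ j * cmonomial_on U L (u - axis j 1) x) x"
proof -
  have "has_cgradient (\<lambda>y. exp (u $ i * L i y))
      (\<lambda>j. (if j = i then u $ i / x $ i else 0) * exp (u $ i * L i x)) x" for i
  proof -
    have "has_cgradient (\<lambda>y. exp (u $ i * L i y))
      (\<lambda>j. exp (u $ i * L i x) * (u $ i * (if j = i then 1 / x $ i else 0))) x"
      by (rule has_cgradient_compose[OF has_cgradient_cmult[OF has_cgradient_log_branch[OF L U x]]])
        (rule DERIV_exp)
    moreover have "(\<lambda>j. exp (u $ i * L i x) * (u $ i * (if j = i then 1 / x $ i else 0))) =
       (\<lambda>j. (if j = i then u $ i / x $ i else 0) * exp (u $ i * L i x))"
      by auto
    ultimately show ?thesis by simp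
  qed
  then have "has_cgradient (\<lambda>y. \<Prod>i\<in>UNIV. exp (u $ i * L i y))
      (\<lambda>j. (\<Sum>i\<in>UNIV. if j = i then u $ i / x $ i else 0) * (\<Prod>i\<in>UNIV. exp (u $ i * L i x))) x"
    by (intro has_cgradient_prod) auto
  then have "has_cgradient (\<lambda>y. \<Prod>i\<in>UNIV. exp (u $ i * L i y))
      (\<lambda>j. u $ j * cmonomial_on U L (u - axis j 1) x) x"
    unfolding cmonomial_on_diff_axis[OF L x] using x by (simp add: cmonomial_on_def)
  then show ?thesis
    using has_cgradient_cong[OF U x, of "\<lambda>y. \<Prod>i\<in>UNIV. exp (u $ i * L i y)" "cmonomial_on U L u"]
    by (simp add: cmonomial_on_def)
qed

lemma holomorphic_sev_on_cmonomial_on: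
  "log_branches U L \<Longrightarrow> open U \<Longrightarrow> holomorphic_sev_on (cmonomial_on U L u) U"
  by (rule holomorphic_sev_onI) (rule has_cgradient_cmonomial_on)

lemma prod_count_list_Cons:
  fixes F :: "'n::finite \<Rightarrow> nat \<Rightarrow> 'a::comm_monoid_mult"
  shows "(\<Prod>j\<in>UNIV. \<Prod>k<count_list (i # is) j. F j k) =
    F i (count_list is i) * (\<Prod>j\<in>UNIV. \<Prod>k<count_list is j. F j k)"
proof -
  have "(\<Prod>j\<in>UNIV. \<Prod>k<count_list (i # is) j. F j k) =
      (\<Prod>j\<in>UNIV. (if j = i then F i (count_list is i) else 1) * (\<Prod>k<count_list is j. F j k))"
    by (rule prod.cong) (auto simp: lessThan_Suc)
  then show ?thesis by (simp add: prod.distrib)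
qed

text \<open>The coefficient is a product of falling factorials; it vanishes as soon as some
  \<open>u $ i\<close> is a natural number below \<open>b $ i\<close>.\<close>

lemma multi_cpartial_cmonomial_on:
  assumes L: "log_branches U L" and U: "open U" and x: "x \<in> U"
  shows "multi_cpartial b (cmonomial_on U L u) x =
    (\<Prod>i\<in>UNIV. \<Prod>k<b $ i. u $ i - of_nat k) * cmonomial_on U L (u - (\<chi> i. of_nat (b $ i))) x"
proof -
  have fold: "foldr cpartial is (cmonomial_on U L u) x = (\<Prod>i\<in>UNIV. \<Prod>k<count_list is i. u $ i - of_nat k) *
    cmonomial_on U L (u - (\<chi> i. of_nat (count_list is i))) x" if "x \<in> U" for "is" x
    using that
  proof (induction "is" arbitrary: x)
    case Nil
    have "(\<chi> i. 0) = (0 :: complex ^ 'a)" by (simp add: vec_eq_iff)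
    then show ?case by simp
  next
    case (Cons i "is")
    let ?c = "\<Prod>i\<in>UNIV. \<Prod>k<count_list is i. u $ i - of_nat k"
    let ?w = "u - (\<chi> i. of_nat (count_list is i))"
    have "cpartial i (foldr cpartial is (cmonomial_on U L u)) x = cpartial i (\<lambda>y. ?c * cmonomial_on U L ?w y) x"
      by (rule cpartial_cong[OF U Cons.prems Cons.IH])
        (auto intro: holomorphic_sev_on_foldr_cpartial[OF holomorphic_sev_on_cmonomial_on[OF L U] U])
    also have "\<dots> = ?c * (?w $ i * cmonomial_on U L (?w - axis i 1) x)"
      by (rule has_cgradient_cpartial(2)[OF has_cgradient_cmult[OF has_cgradient_cmonomial_on[OF L U Cons.prems]]])
    also have "?w - axis i 1 = u - (\<chi> j. of_nat (count_list (i # is) j))"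
      by (auto simp: vec_eq_iff axis_def)
    finally show ?case
      unfolding prod_count_list_Cons by (simp add: mult_ac)
  qed
  obtain "is" where "is": "\<And>i. count_list is i = b $ i" using ex_list_count by blast
  show ?thesis
    using fold[OF x, of "is"] multi_cpartial_eq_foldr[OF holomorphic_sev_on_cmonomial_on[OF L U] U x "is"]
    by (simp add: "is")
qed

text \<open>The quotient of \<open>f\<close> by the monomial has zero gradient, hence is constant on
  the connected set \<open>U\<close>.\<close>

lemma homogeneous_eq_cmonomial_on:
  fixes f :: "complex ^ 'n::finite \<Rightarrow> complex"
  assumes L: "log_branches U L" and U: "open U" "connected U" "U \<noteq> {}"
    and f: "holomorphic_sev_on f U" and z: "\<And>x. x \<notin> U \<Longrightarrow> f x = 0"
    and \<theta>: "\<And>x j. x \<in> U \<Longrightarrow> x $ j * cpartial j f x = v $ j * f x"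
  shows "\<exists>c. f = fun_scale c (cmonomial_on U L v)"
proof -
  define g where "g x = f x * cmonomial_on U L (- v) x" for x
  have "(g has_derivative (\<lambda>h. 0)) (at x)" if x: "x \<in> U" for x
  proof -
    have "has_cgradient g (\<lambda>j. f x * ((- v) $ j * cmonomial_on U L (- v - axis j 1) x) +
        cpartial j f x * cmonomial_on U L (- v) x) x"
      unfolding g_def
      by (intro has_cgradient_mult has_cgradient_cmonomial_on[OF L U(1) x] holomorphic_sev_on_cgradient[OF f x])
    moreover have "f x * ((- v) $ j * cmonomial_on U L (- v - axis j 1) x) +
        cpartial j f x * cmonomial_on U L (- v) x = 0" for j
    proof -
      have "x $ j * (f x * ((- v) $ j * cmonomial_on U L (- v - axis j 1) x) +
        cpartial j f x * cmonomial_on U L (- v) x) = 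
        (x $ j * cpartial j f x - v $ j * f x) * cmonomial_on U L (- v) x"
        using log_branches_nonzero[OF L x, of j]
        by (simp add: cmonomial_on_diff_axis[OF L x] field_simps)
      then show ?thesis using \<theta>[OF x] log_branches_nonzero[OF L x, of j] by simp
    qed
    ultimately show ?thesis by (simp add: has_cgradient_def)
  qed
  then obtain c where c: "\<And>x. x \<in> U \<Longrightarrow> g x = c"
    using has_derivative_zero_unique_connected[OF U(1,2)] U(3) by (metis ex_in_conv)
  have "f x = c * cmonomial_on U L v x" for x
  proof (cases "x \<in> U")
    case True
    have "cmonomial_on U L (- v) x * cmonomial_on U L v x = 1"
      using True by (simp add: cmonomial_on_def prod.distrib[symmetric] exp_add[symmetric])
    then show ?thesis using c[OF True] by (metis g_def mult.assoc mult.right_neutral)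
  qed (simp add: z cmonomial_on_def)
  then show ?thesis by (auto simp: fun_scale_def fun_eq_iff)
qed

section \<open>Functions on a line of exponents\<close>

text \<open>The Nullstellensatz in one variable: an element of least degree divides the whole ideal,
  so a root of it would be a common root, and without roots it is a nonzero constant.\<close>

lemma one_in_complex_poly_ideal:
  fixes I :: "complex poly set"
  assumes add: "\<And>p q. p \<in> I \<Longrightarrow> q \<in> I \<Longrightarrow> p + q \<in> I"
    and mult: "\<And>p q. p \<in> I \<Longrightarrow> q * p \<in> I"
    and nz: "\<And>z. \<exists>p\<in>I. poly p z \<noteq> 0"
  shows "1 \<in> I"
proof -
  define P where "P p \<longleftrightarrow> p \<in> I \<and> p \<noteq> 0" for p
  have "\<exists>p. P p" using nz[of 0] by (auto simp: P_def)
  then obtain g where g: "P g" and min: "\<And>p. P p \<Longrightarrow> degree g \<le> degree p"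
    using ex_has_least_nat[of P _ degree] by metis
  have dvd: "g dvd p" if "p \<in> I" for p
  proof (rule ccontr)
    assume n: "\<not> g dvd p"
    have "p mod g = p + (- (p div g)) * g" by (simp add: minus_div_mult_eq_mod[symmetric])
    then have "p mod g \<in> I" using add[OF that mult[of g "- (p div g)"]] g by (simp add: P_def)
    moreover have "p mod g \<noteq> 0" using n by (simp add: dvd_eq_mod_eq_0)
    ultimately have "degree g \<le> degree (p mod g)" using min by (simp add: P_def)
    moreover have "degree (p mod g) < degree g"
      using degree_mod_less[of g p] g \<open>p mod g \<noteq> 0\<close> by (auto simp: P_def)
    ultimately show False by simp
  qed
  have "\<not> (\<exists>z. poly g z = 0)"
    using nz dvd by (metis dvdE mult_zero_left poly_mult)
  then have "constant (poly g)"
    using fundamental_theorem_of_algebra by blast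
  then have "degree g = 0" using constant_degree by blast
  then obtain c where c: "g = [:c:]" using degree_eq_zeroE by blast
  then have "1 = [:inverse c:] * g" using g by (simp add: P_def one_pCons)
  then show ?thesis using mult[of g "[:inverse c:]"] g by (simp add: P_def)
qed

section \<open>Logarithmic derivatives and polynomials in an operator\<close>

definition log_partial :: "'n \<Rightarrow> (complex ^ 'n \<Rightarrow> complex) \<Rightarrow> complex ^ 'n::finite \<Rightarrow> complex" where
  "log_partial j g x = x $ j * cpartial j g x"

lemma holomorphic_sev_on_log_partial:
  assumes "holomorphic_sev_on g U" "open U"
  shows "holomorphic_sev_on (log_partial j g) U"
  unfolding log_partial_def
  by (rule holomorphic_sev_onI, rule has_cgradient_mult[OF has_cgradient_nth
        holomorphic_sev_on_cgradient[OF holomorphic_sev_on_cpartial[OF assms]]])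

lemma log_partial_commute:
  assumes g: "holomorphic_sev_on g U" and U: "open U" and x: "x \<in> U"
  shows "log_partial i (log_partial j g) x = log_partial j (log_partial i g) x"
proof -
  have "cpartial l (log_partial j g) x =
      x $ j * cpartial l (cpartial j g) x + (if l = j then 1 else 0) * cpartial j g x" for l j
    unfolding log_partial_def
    by (rule has_cgradient_cpartial(2)[OF has_cgradient_mult[OF has_cgradient_nth
            holomorphic_sev_on_cgradient[OF holomorphic_sev_on_cpartial[OF g U] x]]])
  then show ?thesis
    using cpartial_commute[OF g U x, of i j] by (simp add: log_partial_def algebra_simps)
qed

lemma holomorphic_sev_on_lincomb:
  assumes "\<And>k. k \<in> K \<Longrightarrow> holomorphic_sev_on (g k) U"
  shows "holomorphic_sev_on (\<lambda>y. \<Sum>k\<in>K. c k * g k y) U"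
  by (rule holomorphic_sev_onI,
      rule has_cgradient_sum[OF has_cgradient_cmult[OF holomorphic_sev_on_cgradient[OF assms]]])

lemma log_partial_lincomb:
  assumes "\<And>k. k \<in> K \<Longrightarrow> holomorphic_sev_on (g k) U" "x \<in> U"
  shows "log_partial j (\<lambda>y. \<Sum>k\<in>K. c k * g k y) x = (\<Sum>k\<in>K. c k * log_partial j (g k) x)"
proof -
  have "cpartial j (\<lambda>y. \<Sum>k\<in>K. c k * g k y) x = (\<Sum>k\<in>K. c k * cpartial j (g k) x)"
    by (rule has_cgradient_cpartial(2)[OF has_cgradient_sum[OF has_cgradient_cmult[OF
            holomorphic_sev_on_cgradient[OF assms]]]])
  then show ?thesis by (simp add: log_partial_def sum_distrib_left mult.left_commute)
qed

lemma log_partial_cong: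
  assumes "open U" "x \<in> U" "\<And>y. y \<in> U \<Longrightarrow> f y = g y" "holomorphic_sev_on f U"
  shows "log_partial i f x = log_partial i g x"
  unfolding log_partial_def using cpartial_cong[OF assms] by simp

definition poly_act :: "(('a \<Rightarrow> complex) \<Rightarrow> 'a \<Rightarrow> complex) \<Rightarrow> ('a \<Rightarrow> complex) \<Rightarrow> complex poly \<Rightarrow> 'a \<Rightarrow> complex"
  where "poly_act E f p x = (\<Sum>k\<le>degree p. coeff p k * (E ^^ k) f x)"

lemma poly_act_superset:
  assumes "degree p \<le> N"
  shows "poly_act E f p x = (\<Sum>k\<le>N. coeff p k * (E ^^ k) f x)"
  unfolding poly_act_def
  by (rule sum.mono_neutral_left) (use assms in \<open>auto simp: coeff_eq_0\<close>)

lemma poly_act_add: "poly_act E f (p + q) x = poly_act E f p x + poly_act E f q x"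
proof -
  let ?N = "max (degree p) (degree q)"
  have "poly_act E f (p + q) x = (\<Sum>k\<le>?N. coeff (p + q) k * (E ^^ k) f x)"
    by (rule poly_act_superset) (rule degree_add_le_max)
  then show ?thesis
    by (simp add: poly_act_superset[of _ ?N] sum.distrib[symmetric] distrib_right)
qed

lemma poly_act_smult: "poly_act E f (smult c p) x = c * poly_act E f p x"
proof -
  have "poly_act E f (smult c p) x = (\<Sum>k\<le>degree p. coeff (smult c p) k * (E ^^ k) f x)"
    by (rule poly_act_superset) (rule degree_smult_le)
  then show ?thesis by (simp add: poly_act_def sum_distrib_left mult.assoc)
qed

lemma poly_act_pCons0: "poly_act E f (pCons 0 p) x = (\<Sum>k\<le>degree p. coeff p k * (E ^^ Suc k) f x)"
proof -
  have "poly_act E f (pCons 0 p) x = (\<Sum>k\<le>Suc (degree p). coeff (pCons 0 p) k * (E ^^ k) f x)"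
    by (rule poly_act_superset) (simp add: degree_pCons_le)
  then show ?thesis unfolding sum.atMost_Suc_shift by simp
qed

lemma poly_act_one: "poly_act E f 1 x = f x"
  by (simp add: poly_act_def)

text \<open>Writing \<open>f = x\<^sup>v h(log x\<^sup>m)\<close>, the operator \<open>E\<close> replaces \<open>h\<close> by its derivative.\<close>

locale log_line =
  fixes U :: "(complex ^ 'n::finite) set" and f :: "complex ^ 'n \<Rightarrow> complex"
    and v :: "complex ^ 'n" and m :: "'n \<Rightarrow> complex" and E :: "(complex ^ 'n \<Rightarrow> complex) \<Rightarrow> complex ^ 'n \<Rightarrow> complex"
    and a b :: complex and l :: 'n
  assumes U: "open U" and f: "holomorphic_sev_on f U"
    and E: "\<And>g x. E g x = a * log_partial l g x + b * g x"
    and line: "\<And>x j. x \<in> U \<Longrightarrow> log_partial j f x = v $ j * f x + m j * E f x"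
begin

lemma E_hol: "holomorphic_sev_on g U \<Longrightarrow> holomorphic_sev_on (E g) U"
  unfolding E
  by (rule holomorphic_sev_onI, rule has_cgradient_add[OF
        has_cgradient_cmult[OF holomorphic_sev_on_cgradient[OF holomorphic_sev_on_log_partial[OF _ U]]]
        has_cgradient_cmult[OF holomorphic_sev_on_cgradient]])

lemma Epow_hol: "holomorphic_sev_on ((E ^^ k) f) U"
  by (induction k) (auto intro: E_hol f)

lemma poly_act_hol: "holomorphic_sev_on (poly_act E f p) U"
  unfolding poly_act_def by (intro holomorphic_sev_on_lincomb Epow_hol)

lemma E_cong:
  assumes "x \<in> U" "\<And>y. y \<in> U \<Longrightarrow> g y = h y" "holomorphic_sev_on g U"
  shows "E g x = E h x"
  unfolding E using log_partial_cong[OF U assms] assms by simp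

lemma E_poly_act:
  assumes x: "x \<in> U"
  shows "E (poly_act E f p) x = poly_act E f (pCons 0 p) x"
proof -
  have "log_partial l (poly_act E f p) x = (\<Sum>k\<le>degree p. coeff p k * log_partial l ((E ^^ k) f) x)"
    unfolding poly_act_def by (rule log_partial_lincomb[OF Epow_hol x])
  then show ?thesis
    unfolding E[of "poly_act E f p"] poly_act_pCons0 funpow.simps o_def E
    by (simp add: poly_act_def sum_distrib_left sum.distrib[symmetric] algebra_simps)
qed

lemma log_partial_E:
  assumes "holomorphic_sev_on g U" "x \<in> U"
  shows "log_partial j (E g) x = E (log_partial j g) x"
proof -
  have "cpartial j (E g) x = a * cpartial j (log_partial l g) x + b * cpartial j g x"
    unfolding E
    by (intro has_cgradient_cpartial(2) has_cgradient_add has_cgradient_cmult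
        holomorphic_sev_on_cgradient[OF assms]
        holomorphic_sev_on_cgradient[OF holomorphic_sev_on_log_partial[OF assms(1) U] assms(2)])
  then have "log_partial j (E g) x = a * log_partial j (log_partial l g) x + b * log_partial j g x"
    by (simp add: log_partial_def algebra_simps)
  then show ?thesis unfolding E by (simp add: log_partial_commute[OF assms(1) U assms(2), of j l])
qed

text \<open>\<open>E\<close> is a linear combination of \<open>log_partial l\<close> and the
  identity, so it commutes with every \<open>log_partial j\<close>, and the equation
  \<open>line\<close> for \<open>f\<close> passes to all powers.\<close>

lemma log_partial_Epow:
  "x \<in> U \<Longrightarrow> log_partial j ((E ^^ k) f) x = v $ j * (E ^^ k) f x + m j * (E ^^ Suc k) f x"
proof (induction k arbitrary: x)
  case 0
  then show ?case by (simp add: line)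
next
  case (Suc k)
  have "log_partial j ((E ^^ Suc k) f) x = E (log_partial j ((E ^^ k) f)) x"
    by (simp add: log_partial_E[OF Epow_hol Suc.prems])
  also have "\<dots> = E (\<lambda>y. v $ j * (E ^^ k) f y + m j * (E ^^ Suc k) f y) x"
    by (rule E_cong[OF Suc.prems Suc.IH]) (auto intro: holomorphic_sev_on_log_partial Epow_hol U)
  also have "\<dots> = v $ j * E ((E ^^ k) f) x + m j * E ((E ^^ Suc k) f) x"
  proof -
    have "cpartial l (\<lambda>y. v $ j * (E ^^ k) f y + m j * (E ^^ Suc k) f y) x =
       v $ j * cpartial l ((E ^^ k) f) x + m j * cpartial l ((E ^^ Suc k) f) x"
      by (intro has_cgradient_cpartial(2) has_cgradient_add has_cgradient_cmult
        holomorphic_sev_on_cgradient[OF Epow_hol Suc.prems])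
    then show ?thesis unfolding E[of _ x] log_partial_def by (simp add: algebra_simps)
  qed
  finally show ?case by simp
qed

text \<open>On polynomials, \<open>log_partial j\<close> becomes multiplication by
  \<open>v $ j + m j z\<close>; this turns differential equations for \<open>f\<close> into
  polynomial algebra.\<close>

lemma log_partial_poly_act:
  assumes x: "x \<in> U"
  shows "log_partial j (poly_act E f p) x = poly_act E f ([:v $ j, m j:] * p) x"
proof -
  have "log_partial j (poly_act E f p) x = (\<Sum>k\<le>degree p. coeff p k * log_partial j ((E ^^ k) f) x)"
    unfolding poly_act_def by (rule log_partial_lincomb[OF Epow_hol x])
  also have "\<dots> = v $ j * poly_act E f p x + m j * poly_act E f (pCons 0 p) x"
    unfolding log_partial_Epow[OF x] poly_act_pCons0
    by (simp add: poly_act_def sum_distrib_left sum.distrib[symmetric] algebra_simps)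
  finally show ?thesis
    by (simp add: poly_act_add poly_act_smult mult_pCons_left)
       (metis poly_act_smult smult_pCons mult_zero_right)
qed

text \<open>An ideal, as the next lemmas show; its common roots \<open>z\<close> are the candidates
  for exponents \<open>v + z m\<close> occurring in \<open>f\<close>.\<close>

definition ann :: "complex poly set" where
  "ann = {p. \<forall>x\<in>U. poly_act E f p x = 0}"

lemma ann_add: "p \<in> ann \<Longrightarrow> q \<in> ann \<Longrightarrow> p + q \<in> ann"
  by (simp add: ann_def poly_act_add)

lemma ann_pCons0:
  assumes "p \<in> ann"
  shows "pCons 0 p \<in> ann"
  unfolding ann_def
proof (intro CollectI ballI)
  fix x assume x: "x \<in> U"
  have "E (\<lambda>_. 0) x = E (poly_act E f p) x"
    by (rule E_cong[OF x]) (use assms in \<open>auto simp: ann_def intro: holomorphic_sev_onI has_cgradient_const\<close>)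
  moreover have "cpartial l (\<lambda>_. 0) x = 0"
    by (rule has_cgradient_cpartial(2)[OF has_cgradient_const])
  ultimately show "poly_act E f (pCons 0 p) x = 0"
    using E_poly_act[OF x, of p] by (simp add: E log_partial_def)
qed

lemma ann_mult: "p \<in> ann \<Longrightarrow> q * p \<in> ann"
proof (induction q)
  case 0
  then show ?case by (simp add: ann_def poly_act_def)
next
  case (pCons c q)
  have "smult c p \<in> ann" using pCons.prems by (simp add: ann_def poly_act_smult)
  then show ?case using ann_pCons0 pCons by (simp add: mult_pCons_left ann_add)
qed

text \<open>A derivative of order \<open>u\<close>, multiplied by the monomial \<open>x^u\<close>,
  is a product of falling factorials of logarithmic derivatives; here \<open>log_partial j\<close>
  is replaced by \<open>v $ j + m j z\<close>.\<close>

definition indicial :: "nat ^ 'n \<Rightarrow> complex poly" where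
  "indicial u = (\<Prod>j\<in>UNIV. \<Prod>k<u $ j. [:v $ j - of_nat k, m j:])"

lemma poly_indicial: "poly (indicial u) z = (\<Prod>j\<in>UNIV. \<Prod>k<u $ j. v $ j + z * m j - of_nat k)"
  by (simp add: indicial_def poly_prod algebra_simps)

lemma multi_cpartial_poly_act:
  assumes x: "x \<in> U" and U0: "\<And>x j. x \<in> U \<Longrightarrow> x $ j \<noteq> 0"
  shows "multi_cpartial u f x * (\<Prod>j\<in>UNIV. x $ j ^ (u $ j)) = poly_act E f (indicial u) x"
proof -
  \<comment> \<open>In the induction below, the product rule leaves a term with the number
    \<open>n\<close> of earlier derivatives in direction \<open>i\<close>; moving it to the other
    side changes the constant term of the new linear factor to \<open>v $ i - n\<close>.\<close>
  have arith: "X * M * D = R + (- n) * (G * M)" if "X \<noteq> 0" "X * (G * (n / X * M) + D * M) = R"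
    for X G n M D R :: complex
  proof -
    have "X * (G * (n / X * M)) = n * (G * M)" using that(1) by simp
    then show ?thesis using that(2) by (simp add: algebra_simps)
  qed
  have fold: "foldr cpartial is f x * (\<Prod>j\<in>UNIV. x $ j ^ count_list is j) =
    poly_act E f (\<Prod>j\<in>UNIV. \<Prod>k<count_list is j. [:v $ j - of_nat k, m j:]) x" if "x \<in> U" for "is" x
    using that
  proof (induction "is" arbitrary: x)
    case Nil
    then show ?case by (simp add: poly_act_one)
  next
    case (Cons i "is")
    let ?Q = "\<Prod>j\<in>UNIV. \<Prod>k<count_list is j. [:v $ j - of_nat k, m j:]"
    let ?n = "count_list is i"
    let ?m = "\<lambda>x. \<Prod>j\<in>UNIV. x $ j ^ count_list is j"
    let ?G = "foldr cpartial is f"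
    have hG: "holomorphic_sev_on ?G U" by (rule holomorphic_sev_on_foldr_cpartial[OF f U])
    have gm: "has_cgradient ?m (\<lambda>i. of_nat (count_list is i) / x $ i * ?m x) x"
      using has_cgradient_prod_power[of x "\<chi> j. count_list is j"] U0[OF Cons.prems] by simp
    have g1: "has_cgradient (\<lambda>y. ?G y * ?m y)
        (\<lambda>j. ?G x * (of_nat (count_list is j) / x $ j * ?m x) + cpartial j ?G x * ?m x) x"
      by (rule has_cgradient_mult[OF holomorphic_sev_on_cgradient[OF hG Cons.prems] gm])
    have g2: "has_cgradient (\<lambda>y. ?G y * ?m y) (\<lambda>j. cpartial j (poly_act E f ?Q) x) x"
      by (rule iffD2[OF has_cgradient_cong[OF U Cons.prems Cons.IH]
            holomorphic_sev_on_cgradient[OF poly_act_hol Cons.prems]])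
    have "?G x * (of_nat ?n / x $ i * ?m x) + cpartial i ?G x * ?m x = cpartial i (poly_act E f ?Q) x"
      using fun_cong[OF has_cgradient_unique[OF g1 g2], of i] .
    then have "x $ i * (?G x * (of_nat ?n / x $ i * ?m x) + cpartial i ?G x * ?m x) =
        poly_act E f ([:v $ i, m i:] * ?Q) x"
      using log_partial_poly_act[OF Cons.prems, of i ?Q] by (simp add: log_partial_def)
    then have "x $ i * ?m x * cpartial i ?G x = poly_act E f ([:v $ i, m i:] * ?Q) x +
       (- of_nat ?n) * poly_act E f ?Q x"
      unfolding Cons.IH[OF Cons.prems, symmetric] by (rule arith[OF U0[OF Cons.prems]])
    also have "\<dots> = poly_act E f ([:v $ i, m i:] * ?Q + smult (- of_nat ?n) ?Q) x"
      unfolding poly_act_add poly_act_smult ..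
    also have "[:v $ i, m i:] * ?Q + smult (- of_nat ?n) ?Q = [:v $ i - of_nat ?n, m i:] * ?Q"
      by (simp add: mult_pCons_left smult_diff_left)
    finally have "x $ i * ?m x * cpartial i ?G x = poly_act E f ([:v $ i - of_nat ?n, m i:] * ?Q) x" .
    moreover have "(\<Prod>j\<in>UNIV. x $ j ^ count_list (i # is) j) = x $ i * ?m x"
      using prod_count_list_Cons[of "\<lambda>j k. x $ j" i "is"] by simp
    ultimately show ?case
      unfolding prod_count_list_Cons by (simp add: mult_ac)
  qed
  obtain "is" where "is": "\<And>i. count_list is i = u $ i" using ex_list_count by blast
  show ?thesis
    using fold[OF x, of "is"] multi_cpartial_eq_foldr[OF f U x "is"] by (simp add: "is" indicial_def)
qed

lemma indicial_in_ann:
  assumes "\<And>x j. x \<in> U \<Longrightarrow> x $ j \<noteq> 0" "\<And>x. x \<in> U \<Longrightarrow> multi_cpartial u f x = 0"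
  shows "indicial u \<in> ann"
  using multi_cpartial_poly_act[OF _ assms(1), of _ u] assms(2) by (auto simp: ann_def)

text \<open>Without a common root \<open>ann\<close> contains the polynomial 1, which acts as the
  identity.\<close>

lemma zero_if_no_common_root:
  assumes "\<And>z. \<exists>p\<in>ann. poly p z \<noteq> 0" "x \<in> U"
  shows "f x = 0"
proof -
  have "1 \<in> ann" by (rule one_in_complex_poly_ideal[OF ann_add ann_mult assms(1)])
  then show ?thesis using assms(2) by (simp add: ann_def poly_act_one)
qed

text \<open>The colon ideal of all \<open>p\<close> whose product with the indeterminate lies in
  \<open>ann\<close> has no common root: it contains \<open>ann\<close>, which handles nonzero
  points, and \<open>r\<close>, which handles 0. So it contains 1, which means that
  \<open>E f\<close> vanishes on \<open>U\<close>.\<close>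

lemma homogeneous_if_simple_common_root:
  assumes "\<And>z. z \<noteq> 0 \<Longrightarrow> \<exists>p\<in>ann. poly p z \<noteq> 0"
    and "pCons 0 r \<in> ann" "poly r 0 \<noteq> 0" "x \<in> U"
  shows "log_partial j f x = v $ j * f x"
proof -
  have "1 \<in> {p. pCons 0 p \<in> ann}"
  proof (rule one_in_complex_poly_ideal)
    fix p q assume "p \<in> {p. pCons 0 p \<in> ann}" "q \<in> {p. pCons 0 p \<in> ann}"
    then show "p + q \<in> {p. pCons 0 p \<in> ann}" using ann_add[of "pCons 0 p" "pCons 0 q"] by simp
  next
    fix p q assume "p \<in> {p. pCons 0 p \<in> ann}"
    then show "q * p \<in> {p. pCons 0 p \<in> ann}" using ann_mult[of "pCons 0 p" q] by simp
  next
    fix z show "\<exists>p\<in>{p. pCons 0 p \<in> ann}. poly p z \<noteq> 0"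
      using assms(1)[of z] assms(2,3) ann_pCons0 by (cases "z = 0") auto
  qed
  then have "E (poly_act E f 1) x = 0"
    using E_poly_act[OF assms(4), of 1] assms(4) by (simp add: ann_def)
  moreover have "poly_act E f 1 = f" by (simp add: fun_eq_iff poly_act_one)
  ultimately show ?thesis using line[OF assms(4), of j] by simp
qed

end

section \<open>Initial ideals and standard pairs\<close>

lemma wt_neg_axis: "wt (- axis i 1) u = - real (u $ i)"
proof -
  have "wt (- axis i 1) u = (\<Sum>j\<in>UNIV. if j = i then - real (u $ j) else 0)"
    unfolding wt_def by (rule sum.cong) (auto simp: axis_def)
  then show ?thesis by simp
qed

lemma lookup_initial_form:
  "Poly_Mapping.lookup (initial_form w f) a =
    (if \<forall>u'\<in>Poly_Mapping.keys f. wt w u' \<le> wt w a then Poly_Mapping.lookup f a else 0)"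
proof -
  let ?K = "{u \<in> Poly_Mapping.keys f. \<forall>u'\<in>Poly_Mapping.keys f. wt w u' \<le> wt w u}"
  have "Poly_Mapping.lookup (initial_form w f) a = (\<Sum>u\<in>?K. if u = a then Poly_Mapping.lookup f u else 0)"
    unfolding initial_form_def lookup_sum lookup_single when_def by simp
  also have "\<dots> = (if a \<in> ?K then Poly_Mapping.lookup f a else 0)"
    by (simp add: sum.delta')
  finally show ?thesis by (auto simp: in_keys_iff)
qed

lemma dmonom_mult: "dmonom a * dmonom b = dmonom (a + b)"
  by (simp add: dmonom_def mult_single)

lemma lookup_dmonom: "Poly_Mapping.lookup (dmonom a) b = (if a = b then 1 else 0)"
  by (simp add: dmonom_def lookup_single when_def)

lemma keys_dmonom: "Poly_Mapping.keys (dmonom a) = {a}"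
  by (simp add: dmonom_def)

lemma initial_form_dmonom: "initial_form w (dmonom a) = dmonom a"
  by (rule poly_mapping_eqI) (auto simp: lookup_initial_form lookup_dmonom keys_dmonom)

lemma initial_form_binomial:
  assumes "a $ i < b $ i"
  shows "initial_form (- axis i 1) (dmonom a - dmonom b) = dmonom a"
proof (rule poly_mapping_eqI)
  fix c
  have "a \<noteq> b" using assms by auto
  then have "Poly_Mapping.keys (dmonom a - dmonom b) = {a, b}"
    by (auto simp: in_keys_iff lookup_minus lookup_dmonom split: if_splits)
  then show "Poly_Mapping.lookup (initial_form (- axis i 1) (dmonom a - dmonom b)) c =
      Poly_Mapping.lookup (dmonom a) c"
    using assms \<open>a \<noteq> b\<close>
    by (auto simp: lookup_initial_form wt_neg_axis lookup_minus lookup_dmonom)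
qed

text \<open>Under the weight \<open>- axis i 1\<close> the binomial leads with the monomial whose
  exponent at \<open>i\<close> is smaller. The perturbed weight keeps it, as a monomial is its own
  initial form.\<close>

lemma dmonom_in_initial_ideal:
  assumes w: "admissible_weight A i w'" and ab: "A *v ivec a = A *v ivec b" "a $ i < b $ i"
  shows "dmonom a \<in> initial_ideal w' (toric_ideal A)"
proof -
  let ?J = "initial_ideal (- axis i 1) (toric_ideal A)"
  have J: "dmonom a \<in> ?J"
    unfolding initial_ideal_def
    using toric_ideal_binomial[OF ab(1)] initial_form_binomial[OF ab(2)]
    by (intro ideal_gen_base) (metis imageI)
  show ?thesis
  proof (cases "monomial_ideal ?J")
    case True
    then show ?thesis using w J by (simp add: admissible_weight_def Let_def)
  next
    case False
    then obtain w where "initial_ideal w' (toric_ideal A) = initial_ideal w ?J"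
      using w by (auto simp: admissible_weight_def Let_def)
    moreover have "dmonom a \<in> initial_ideal w ?J"
      unfolding initial_ideal_def[of w]
      using J initial_form_dmonom[of w a] by (intro ideal_gen_base) (metis imageI)
    ultimately show ?thesis by simp
  qed
qed

text \<open>\<open>T\<close> is closed under divisors, so a term of \<open>r * s\<close> with
  exponent in \<open>T\<close> needs a term of \<open>s\<close> with exponent in
  \<open>T\<close>.\<close>

lemma ideal_gen_lookup_eq_0:
  fixes S :: "'n::finite dpoly set"
  assumes T: "\<And>b c. c + b \<in> T \<Longrightarrow> b \<in> T"
    and S: "\<And>s a. s \<in> S \<Longrightarrow> a \<in> T \<Longrightarrow> Poly_Mapping.lookup s a = 0"
    and p: "p \<in> ideal_gen S"
  shows "\<forall>a\<in>T. Poly_Mapping.lookup p a = 0"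
  using p
proof (induction rule: ideal_gen_induct)
  case (mult r s)
  show ?case
  proof (intro ballI, rule ccontr)
    fix a assume a: "a \<in> T" "Poly_Mapping.lookup (r * s) a \<noteq> 0"
    then obtain c b where "a = c + b" "b \<in> Poly_Mapping.keys s"
      using keys_mult[of r s] by (auto simp: in_keys_iff subset_iff)
    then show False using T S[OF mult] a by (auto simp: in_keys_iff)
  qed
qed (simp_all add: lookup_add)

text \<open>These exponents have strictly the least weight in their fibre for
  \<open>- axis i 1\<close>; they turn out to be standard monomials.\<close>

definition unique_top :: "int ^ 'n::finite ^ 'd::finite \<Rightarrow> 'n \<Rightarrow> (nat ^ 'n) set" where
  "unique_top A i = {a. \<forall>b. A *v ivec b = A *v ivec a \<longrightarrow> a $ i \<le> b $ i \<longrightarrow> b = a}"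

lemma unique_top_divisor:
  assumes "c + b \<in> unique_top A i"
  shows "b \<in> unique_top A i"
  unfolding unique_top_def
proof (intro CollectI allI impI)
  fix b' assume "A *v ivec b' = A *v ivec b" "b $ i \<le> b' $ i"
  then have "A *v ivec (c + b') = A *v ivec (c + b)" "(c + b) $ i \<le> (c + b') $ i"
    by (simp_all add: ivec_add matrix_vector_right_distrib)
  then have "c + b' = c + b" using assms unfolding unique_top_def by blast
  then show "b' = b" by simp
qed

text \<open>Such a monomial could survive in an initial form only as the sole term of its fibre. But
  the coefficients of a toric polynomial add up to zero on every fibre.\<close>

lemma unique_top_notin_initial_ideal:
  assumes w: "admissible_weight A i w'" and a: "a \<in> unique_top A i"
  shows "dmonom a \<notin> initial_ideal w' (toric_ideal A)"
proof -
  let ?J = "initial_ideal (- axis i 1) (toric_ideal A)"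
  have gen: "Poly_Mapping.lookup (initial_form (- axis i 1) f) a = 0"
    if f: "f \<in> toric_ideal A" and a: "a \<in> unique_top A i" for f a
  proof (rule ccontr)
    assume "Poly_Mapping.lookup (initial_form (- axis i 1) f) a \<noteq> 0"
    then have max: "\<And>u. u \<in> Poly_Mapping.keys f \<Longrightarrow> a $ i \<le> u $ i" and nz: "Poly_Mapping.lookup f a \<noteq> 0"
      by (auto simp: lookup_initial_form wt_neg_axis split: if_splits)
    have "pm_eval (\<lambda>b. if A *v ivec b = A *v ivec a then 1 else 0) f = 0"
      by (rule toric_ideal_pm_eval[OF f]) auto
    moreover have "pm_eval (\<lambda>b. if A *v ivec b = A *v ivec a then 1 else 0) f =
        (\<Sum>k\<in>Poly_Mapping.keys f. if k = a then Poly_Mapping.lookup f k else 0)"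
      unfolding pm_eval_def using max a by (intro sum.cong) (auto simp: unique_top_def)
    ultimately show False using nz by (simp add: in_keys_iff sum.delta')
  qed
  have J: "\<forall>a\<in>unique_top A i. Poly_Mapping.lookup p a = 0" if "p \<in> ?J" for p
    by (rule ideal_gen_lookup_eq_0[OF unique_top_divisor _ that[unfolded initial_ideal_def]])
      (use gen in auto)
  show ?thesis
  proof (cases "monomial_ideal ?J")
    case True
    then show ?thesis using w J a lookup_dmonom[of a a]
      by (auto simp: admissible_weight_def Let_def)
  next
    case False
    then obtain w where eq: "initial_ideal w' (toric_ideal A) = initial_ideal w ?J"
      using w by (auto simp: admissible_weight_def Let_def)
    \<comment> \<open>Taking initial forms for \<open>w\<close> only removes terms, so the vanishing
      on \<open>unique_top A i\<close> survives.\<close>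
    have "\<forall>a\<in>unique_top A i. Poly_Mapping.lookup p a = 0" if "p \<in> initial_ideal w ?J" for p
      by (rule ideal_gen_lookup_eq_0[OF unique_top_divisor _ that[unfolded initial_ideal_def[of w]]])
        (use J in \<open>auto simp: lookup_initial_form\<close>)
    then show ?thesis using a eq lookup_dmonom[of a a] by auto
  qed
qed

text \<open>\<open>\<sigma>0\<close> is enlarged to a maximal set of free directions that avoids
  \<open>M\<close>. Maximality provides, for each further direction, the monomial in
  \<open>M\<close> which the last condition of a standard pair asks for.\<close>

lemma standard_pair_exists:
  fixes \<eta> :: "nat ^ 'n::finite"
  assumes M: "\<And>r s. s \<in> M \<Longrightarrow> r * s \<in> M"
    and notin: "\<And>\<mu>. (\<forall>i. i \<notin> \<sigma>0 \<longrightarrow> \<mu> $ i = \<eta> $ i) \<Longrightarrow> dmonom \<mu> \<notin> M"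
  shows "\<exists>\<eta>' \<sigma>. standard_pair M \<eta>' \<sigma> \<and> \<sigma>0 \<subseteq> \<sigma> \<and> (\<forall>i. i \<notin> \<sigma> \<longrightarrow> \<eta>' $ i = \<eta> $ i)"
proof -
  define C where "C = {\<sigma>. \<sigma>0 \<subseteq> \<sigma> \<and> (\<forall>\<mu>. (\<forall>i. i \<notin> \<sigma> \<longrightarrow> \<mu> $ i = \<eta> $ i) \<longrightarrow> dmonom \<mu> \<notin> M)}"
  have "\<sigma>0 \<in> C" using notin by (simp add: C_def)
  then obtain \<sigma> where \<sigma>: "\<sigma> \<in> C" and max: "\<And>\<tau>. \<tau> \<in> C \<Longrightarrow> \<sigma> \<subseteq> \<tau> \<Longrightarrow> \<tau> = \<sigma>"
    using finite_has_maximal2[of C \<sigma>0] by auto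
  define \<eta>' where "\<eta>' = (\<chi> i. if i \<in> \<sigma> then 0 else \<eta> $ i)"
  have "standard_pair M \<eta>' \<sigma>"
    unfolding standard_pair_def
  proof (intro conjI allI impI ballI)
    fix i assume "i \<in> \<sigma>" then show "\<eta>' $ i = 0" by (simp add: \<eta>'_def)
  next
    fix \<mu> :: "nat ^ 'n" assume "\<forall>i. i \<notin> \<sigma> \<longrightarrow> \<mu> $ i = 0"
    then show "dmonom (\<eta>' + \<mu>) \<notin> M" using \<sigma> by (simp add: C_def \<eta>'_def)
  next
    fix l assume l: "l \<notin> \<sigma>"
    then have "insert l \<sigma> \<notin> C" using max by blast
    then obtain \<mu> where \<mu>: "\<forall>i. i \<notin> insert l \<sigma> \<longrightarrow> \<mu> $ i = \<eta> $ i" "dmonom \<mu> \<in> M"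
      using \<sigma> by (auto simp: C_def)
    \<comment> \<open>The monomial found has an arbitrary exponent at \<open>l\<close>, while
      \<open>\<eta>'\<close> already contributes \<open>\<eta> $ l\<close> there; multiplying by
      that power of the \<open>l\<close>-th variable stays in \<open>M\<close>.\<close>
    define \<nu> where "\<nu> = (\<chi> i. if i \<in> insert l \<sigma> then \<mu> $ i else 0)"
    have "\<eta>' + \<nu> = axis l (\<eta> $ l) + \<mu>"
      using \<mu>(1) l by (auto simp: vec_eq_iff \<eta>'_def \<nu>_def axis_def)
    then have "dmonom (\<eta>' + \<nu>) \<in> M"
      using M[OF \<mu>(2), of "dmonom (axis l (\<eta> $ l))"] by (simp add: dmonom_mult)
    then show "\<exists>\<mu>. (\<forall>i. i \<notin> insert l \<sigma> \<longrightarrow> \<mu> $ i = 0) \<and> dmonom (\<eta>' + \<mu>) \<in> M"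
      by (intro exI[of _ \<nu>]) (auto simp: \<nu>_def)
  qed
  then show ?thesis using \<sigma> by (intro exI[of _ \<eta>'] exI[of _ \<sigma>]) (auto simp: C_def \<eta>'_def)
qed

text \<open>If \<open>y\<close> stayed below \<open>\<eta>\<close> off \<open>\<sigma>\<close>, free
  variables could be added until \<open>y\<close> can be subtracted. The result lies in the same
  fibre with a larger \<open>i\<close>-th coordinate, which would put a monomial of the standard
  pair into the initial ideal.\<close>

lemma standard_pair_no_decrease:
  assumes w: "admissible_weight A i w'" and sp: "standard_pair (initial_ideal w' (toric_ideal A)) \<eta> \<sigma>"
    and y: "A *v y = 0" "y $ i < 0"
  shows "\<exists>j. j \<notin> \<sigma> \<and> int (\<eta> $ j) < y $ j"
proof (rule ccontr)
  assume "\<not> ?thesis"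
  then have le: "\<And>j. j \<notin> \<sigma> \<Longrightarrow> y $ j \<le> int (\<eta> $ j)" by force
  define \<mu> where "\<mu> = (\<chi> j. if j \<in> \<sigma> then nat \<bar>y $ j\<bar> else 0)"
  define b where "b = (\<chi> j. nat (int ((\<eta> + \<mu>) $ j) - y $ j))"
  have b: "ivec b = ivec (\<eta> + \<mu>) - y"
    using le by (auto simp: vec_eq_iff b_def \<mu>_def)
  have "A *v ivec (\<eta> + \<mu>) = A *v ivec b"
    unfolding b by (simp add: matrix_vector_mult_diff_distrib y)
  moreover have "(\<eta> + \<mu>) $ i < b $ i"
    using y(2) by (simp add: b_def)
  ultimately have "dmonom (\<eta> + \<mu>) \<in> initial_ideal w' (toric_ideal A)"
    by (rule dmonom_in_initial_ideal[OF w])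
  then show False using sp by (auto simp: standard_pair_def \<mu>_def)
qed

section \<open>Exponents in codimension two\<close>

lemma complex_subfield_closed:
  assumes F: "complex_subfield F"
  shows "0 \<in> F" "1 \<in> F" "\<And>x y. x \<in> F \<Longrightarrow> y \<in> F \<Longrightarrow> x - y \<in> F"
    "\<And>x y. x \<in> F \<Longrightarrow> y \<in> F \<Longrightarrow> x + y \<in> F" "\<And>x y. x \<in> F \<Longrightarrow> y \<in> F \<Longrightarrow> x * y \<in> F"
    "\<And>x y. x \<in> F \<Longrightarrow> y \<in> F \<Longrightarrow> x / y \<in> F" "\<And>k. of_int k \<in> F"
proof -
  show 0: "0 \<in> F" and 1: "1 \<in> F" and d: "\<And>x y. x \<in> F \<Longrightarrow> y \<in> F \<Longrightarrow> x - y \<in> F"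
    and m: "\<And>x y. x \<in> F \<Longrightarrow> y \<in> F \<Longrightarrow> x * y \<in> F"
    using F by (auto simp: complex_subfield_def)
  show a: "x + y \<in> F" if "x \<in> F" "y \<in> F" for x y
    using d[OF that(1) d[OF 0 that(2)]] by simp
  show "x / y \<in> F" if "x \<in> F" "y \<in> F" for x y
    using that m F unfolding complex_subfield_def divide_inverse by blast
  show "of_int k \<in> F" for k
    by (induction k rule: int_induct[of _ 0]) (auto simp: 0 1 a d)
qed

locale gale =
  fixes A :: "int ^ 'n::finite ^ 'd::finite"
    and B :: "int ^ 2 ^ 'n"
    and i1 i2 i3 i4 :: 'n
    and \<alpha> :: "'n \<Rightarrow> complex"
    and v :: "complex ^ 'n"
  assumes codim: "CARD('n) = CARD('d) + 2"
    and rank_A: "rank (real_mat A) = CARD('d)"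
    and basis_B: "bij_betw (\<lambda>z :: int ^ 2. B *v z) UNIV {u. A *v u = 0}"
    and idx: "distinct [i1, i2, i3, i4]"
    and row1: "B $ i1 $ 1 > 0" "B $ i1 $ 2 > 0"
    and row2: "B $ i2 $ 1 < 0" "B $ i2 $ 2 > 0"
    and row3: "B $ i3 $ 1 < 0" "B $ i3 $ 2 < 0"
    and row4: "B $ i4 $ 1 > 0" "B $ i4 $ 2 < 0"
    and \<alpha>_irrational: "\<And>i. i \<notin> {i1, i2, i3, i4} \<Longrightarrow> \<alpha> i \<notin> \<rat>"
    and \<alpha>_generic: "\<And>i. i \<notin> {i1, i2, i3, i4} \<Longrightarrow>
      \<alpha> i \<notin> rat_adjoin (\<alpha> ` (UNIV - {i1, i2, i3, i4, i}))"
    and v_def: "v = complex_vec (pos_part (column 1 B) + pos_part (column 2 B))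
      - axis i1 1 - axis i2 1 - axis i4 1 + (\<Sum>i \<in> UNIV - {i1, i2, i3, i4}. axis i (\<alpha> i))"
begin

lemma Bz: "(B *v z) $ j = B $ j $ 1 * z $ 1 + B $ j $ 2 * z $ 2"
  by (simp add: matrix_vector_mult_def sum_2)

text \<open>The signs of the four distinguished rows decide which positive parts survive; at
  \<open>i1\<close>, \<open>i2\<close>, \<open>i4\<close> the value is one less than the sum of the
  positive entries of the row of \<open>B\<close>.\<close>

lemma v_nth:
  "v $ i1 = of_int (B $ i1 $ 1 + B $ i1 $ 2 - 1)" "v $ i2 = of_int (B $ i2 $ 2 - 1)"
  "v $ i3 = 0" "v $ i4 = of_int (B $ i4 $ 1 - 1)"
  "j \<notin> {i1, i2, i3, i4} \<Longrightarrow> \<exists>k. v $ j = of_int k + \<alpha> j"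
proof -
  define S where "S = (\<Sum>i \<in> UNIV - {i1, i2, i3, i4}. axis i (\<alpha> i))"
  have s: "S $ j = (if j \<in> {i1, i2, i3, i4} then 0 else \<alpha> j)" for j
  proof -
    have "S $ j = (\<Sum>i \<in> UNIV - {i1, i2, i3, i4}. if i = j then \<alpha> i else 0)"
      unfolding S_def sum_component by (rule sum.cong) (auto simp: axis_def)
    then show ?thesis by simp
  qed
  show "v $ i1 = of_int (B $ i1 $ 1 + B $ i1 $ 2 - 1)" "v $ i2 = of_int (B $ i2 $ 2 - 1)"
    "v $ i3 = 0" "v $ i4 = of_int (B $ i4 $ 1 - 1)"
    using idx row1 row2 row3 row4 unfolding v_def S_def[symmetric]
    by (auto simp: complex_vec_def pos_part_def column_def axis_def s)
  assume j: "j \<notin> {i1, i2, i3, i4}"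
  then have "v $ j = of_int ((pos_part (column 1 B) + pos_part (column 2 B)) $ j) + \<alpha> j"
    unfolding v_def S_def[symmetric] by (auto simp: complex_vec_def axis_def s)
  then show "\<exists>k. v $ j = of_int k + \<alpha> j" by blast
qed

text \<open>\<open>m = B (b\<^sub>3\<^sub>2, - b\<^sub>3\<^sub>1)\<close> spans the kernel vectors of \<open>A\<close> that vanish at \<open>i3\<close>.\<close>

definition m :: "'n \<Rightarrow> int" where
  "m j = B $ j $ 1 * B $ i3 $ 2 - B $ j $ 2 * B $ i3 $ 1"

lemma m_signs: "m i2 > 0" "m i4 < 0" "m i3 = 0"
proof -
  show "m i2 > 0"
    using mult_neg_neg[OF row2(1) row3(2)] mult_pos_neg[OF row2(2) row3(1)] by (simp add: m_def)
  show "m i4 < 0"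
    using mult_pos_neg[OF row4(1) row3(2)] mult_neg_neg[OF row4(2) row3(1)] by (simp add: m_def)
qed (simp add: m_def)

text \<open>If \<open>descends u\<close>, then \<open>x\<^sup>u\<close> is not annihilated by the monomials of the initial ideal.\<close>

definition descends :: "complex ^ 'n \<Rightarrow> bool" where
  "descends u \<longleftrightarrow> (\<exists>z :: int ^ 2. (B *v z) $ i3 < 0 \<and>
     (\<forall>j n. u $ j = of_nat n \<longrightarrow> (B *v z) $ j \<le> int n))"

lemma descendsI:
  assumes "B $ i3 $ 1 * z1 + B $ i3 $ 2 * z2 < 0"
    and "\<And>j n. u $ j = of_nat n \<Longrightarrow> B $ j $ 1 * z1 + B $ j $ 2 * z2 \<le> int n"
  shows "descends u"
  unfolding descends_def using assms by (intro exI[of _ "vector [z1, z2]"]) (simp add: Bz)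

definition on_line :: "complex \<Rightarrow> complex ^ 'n" where
  "on_line t = (\<chi> j. v $ j + t * of_int (m j))"

text \<open>Solving for \<open>\<alpha> i\<close> expresses it through \<open>t\<close> with integer
  coefficients; a rational \<open>t\<close> or a zero slope would make it rational.\<close>

lemma on_line_rational:
  assumes i: "i \<notin> {i1, i2, i3, i4}" and n: "on_line t $ i = of_nat n"
  shows "t \<notin> \<rat>" "m i \<noteq> 0"
proof -
  obtain k where k: "v $ i = of_int k + \<alpha> i" using v_nth(5)[OF i] by blast
  have a: "\<alpha> i = of_nat n - of_int k - t * of_int (m i)"
    using n by (simp add: on_line_def k algebra_simps)
  then show "t \<notin> \<rat>" using \<alpha>_irrational[OF i] by auto
  show "m i \<noteq> 0" using a \<alpha>_irrational[OF i] by auto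
qed

text \<open>Two such coordinates would determine \<open>t\<close> from \<open>\<alpha> j\<close> and
  then express \<open>\<alpha> i\<close> rationally in \<open>\<alpha> j\<close>, against
  genericity.\<close>

lemma on_line_generic:
  assumes i: "i \<notin> {i1, i2, i3, i4}" "on_line t $ i = of_nat n"
    and j: "j \<notin> {i1, i2, i3, i4}" "on_line t $ j = of_nat n'"
  shows "i = j"
proof (rule ccontr)
  assume ne: "i \<noteq> j"
  obtain k where k: "v $ i = of_int k + \<alpha> i" using v_nth(5)[OF i(1)] by blast
  obtain l where l: "v $ j = of_int l + \<alpha> j" using v_nth(5)[OF j(1)] by blast
  have mj: "m j \<noteq> 0" by (rule on_line_rational(2)[OF j])
  have t: "t = (of_int (int n') - of_int l - \<alpha> j) / of_int (m j)"
    using j(2) mj by (simp add: on_line_def l field_simps)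
  have a: "\<alpha> i = of_int (int n) - of_int k - t * of_int (m i)"
    using i(2) by (simp add: on_line_def k algebra_simps)
  have "\<alpha> i \<in> F" if F: "complex_subfield F" "\<alpha> ` (UNIV - {i1, i2, i3, i4, i}) \<subseteq> F" for F
  proof -
    have "\<alpha> j \<in> F" using F(2) j(1) ne by auto
    then show ?thesis
      unfolding a t by (intro complex_subfield_closed[OF F(1)])
  qed
  then show False using \<alpha>_generic[OF i(1)] by (auto simp: rat_adjoin_def)
qed

text \<open>Three cases: a coordinate outside the first four is natural, which makes
  \<open>t\<close> irrational; otherwise \<open>t\<close> is not real, or it is real and a lattice
  point is found by rounding up.\<close>

lemma descends_on_line:
  assumes t: "t \<noteq> 0"
  shows "descends (on_line t)"
proof (cases "\<exists>i n. i \<notin> {i1, i2, i3, i4} \<and> on_line t $ i = of_nat n")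
  case True
  then obtain i n where i: "i \<notin> {i1, i2, i3, i4}" "on_line t $ i = of_nat n" by blast
  \<comment> \<open>The witness is \<open>(1, 0)\<close> plus \<open>k\<close> times the vector
    \<open>(b32, -b31)\<close> that \<open>B\<close> sends to \<open>m\<close>. This does not affect
    the value at \<open>i3\<close> and pushes the value at \<open>i\<close> down to at most
    zero.\<close>
  define k where "k = - sgn (m i) * \<bar>B $ i $ 1\<bar>"
  have irr: "t \<notin> \<rat>" "m i \<noteq> 0" using on_line_rational[OF i] by auto
  have val: "B $ j $ 1 * (1 + k * B $ i3 $ 2) + B $ j $ 2 * (- k * B $ i3 $ 1) = B $ j $ 1 + k * m j" for j
    by (simp add: m_def algebra_simps)
  show ?thesis
  proof (rule descendsI[of "1 + k * B $ i3 $ 2" "- k * B $ i3 $ 1"], unfold val)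
    show "B $ i3 $ 1 + k * m i3 < 0" using row3 m_signs by simp
    fix j n' assume j: "on_line t $ j = of_nat n'"
    consider "j \<notin> {i1, i2, i3, i4}" | "j = i3" | "j \<in> {i1, i2, i4}" by blast
    then show "B $ j $ 1 + k * m j \<le> int n'"
    proof cases
      case 1
      then have "j = i" using on_line_generic[OF i 1 j] by simp
      moreover have "B $ i $ 1 + k * m i \<le> 0"
      proof -
        have "k * m i = - (\<bar>m i\<bar> * \<bar>B $ i $ 1\<bar>)" by (simp add: k_def abs_sgn)
        moreover have "1 * \<bar>B $ i $ 1\<bar> \<le> \<bar>m i\<bar> * \<bar>B $ i $ 1\<bar>"
          using irr(2) by (intro mult_right_mono) auto
        ultimately show ?thesis by linarith
      qed
      ultimately show ?thesis by simp
    next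
      case 2
      then show ?thesis using row3 m_signs by simp
    next
      case 3
      then obtain l where l: "v $ j = of_int l" using v_nth by blast
      \<comment> \<open>A natural coordinate with integral \<open>v $ j\<close> and nonzero slope
        would make \<open>t\<close> rational. By the signs of \<open>m\<close> this leaves only
        \<open>i1\<close>, where the bound comes from \<open>B $ i1 $ 2 > 0\<close>.\<close>
      have mj: "m j = 0"
      proof (rule ccontr)
        assume "m j \<noteq> 0"
        then have "t = (of_nat n' - of_int l) / of_int (m j)"
          using j by (simp add: on_line_def l field_simps)
        then show False using irr(1) by simp
      qed
      then have "j = i1" using 3 m_signs by auto
      then have "of_int (int n') = (of_int (B $ i1 $ 1 + B $ i1 $ 2 - 1) :: complex)"
        using j mj v_nth(1) by (simp add: on_line_def)
      then have "int n' = B $ i1 $ 1 + B $ i1 $ 2 - 1" by (simp only: of_int_eq_iff)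
      then show ?thesis using row1 mj \<open>j = i1\<close> by simp
    qed
  qed
next
  case False
  then have outside: "j \<in> {i1, i2, i3, i4}" if "on_line t $ j = of_nat n" for j n
    using that by blast
  show ?thesis
  proof (cases "t \<in> \<real>")
    case False
    show ?thesis
    \<comment> \<open>For nonreal \<open>t\<close>, a coordinate among the first four with nonzero
      slope is not real. Only \<open>i3\<close> and possibly \<open>i1\<close> put a condition on
      \<open>z\<close>, and \<open>(1, 0)\<close> satisfies both.\<close>
    proof (rule descendsI[of 1 0])
      fix j n assume j: "on_line t $ j = of_nat n"
      show "B $ j $ 1 * 1 + B $ j $ 2 * 0 \<le> int n"
      proof (cases "j = i3")
        case False
        then have "j \<in> {i1, i2, i4}" using outside[OF j] by blast
        then obtain l where l: "v $ j = of_int l" using v_nth by blast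
        have mj: "m j = 0"
        proof (rule ccontr)
          assume "m j \<noteq> 0"
          then have "t = (of_nat n - of_int l) / of_int (m j)"
            using j by (simp add: on_line_def l field_simps)
          then show False using \<open>t \<notin> \<real>\<close> by simp
        qed
        then have "j = i1" using \<open>j \<in> {i1, i2, i4}\<close> m_signs by auto
        then have "of_int (int n) = (of_int (B $ i1 $ 1 + B $ i1 $ 2 - 1) :: complex)"
          using j mj v_nth(1) by (simp add: on_line_def)
        then have "int n = B $ i1 $ 1 + B $ i1 $ 2 - 1" by (simp only: of_int_eq_iff)
        then show ?thesis using row1 \<open>j = i1\<close> by simp
      qed (use row3 in simp)
    qed (use row3 in simp)
  next
    case True
    then obtain r where r: "t = of_real r" by (auto elim: Reals_cases)
    have coord: "real n = real_of_int l + r * real_of_int (m j)"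
      if "on_line t $ j = of_nat n" "v $ j = of_int l" for j n l
    proof -
      have "complex_of_real (real n) = of_real (real_of_int l + r * real_of_int (m j))"
        using that by (simp add: on_line_def r)
      then show ?thesis by (simp only: of_real_eq_iff)
    qed
    \<comment> \<open>\<open>B\<close> sends the real point \<open>(r b32, - r b31)\<close> to
      \<open>r m\<close>; rounding up gives the lattice point in its translated half-open unit
      square, with offsets \<open>s1\<close> and \<open>s2\<close>.\<close>
    define z1 z2 where "z1 = \<lceil>r * B $ i3 $ 2\<rceil>" and "z2 = \<lceil>- r * B $ i3 $ 1\<rceil>"
    define s1 s2 where "s1 = z1 - r * B $ i3 $ 2" and "s2 = z2 + r * B $ i3 $ 1"
    have s: "0 \<le> s1" "s1 < 1" "0 \<le> s2" "s2 < 1"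
      unfolding s1_def s2_def z1_def z2_def by linarith+
    have val: "real_of_int (B $ j $ 1 * z1 + B $ j $ 2 * z2) =
        r * m j + (B $ j $ 1 * s1 + B $ j $ 2 * s2)" for j
      by (simp add: s1_def s2_def m_def algebra_simps)
    show ?thesis
    proof (cases "s1 = 0 \<and> s2 = 0")
      case False
      show ?thesis
      proof (rule descendsI[of z1 z2])
        have "real_of_int (B $ i3 $ 1) * s1 \<le> 0" "real_of_int (B $ i3 $ 2) * s2 \<le> 0"
          "real_of_int (B $ i3 $ 1) * s1 < 0 \<or> real_of_int (B $ i3 $ 2) * s2 < 0"
          using row3 s False by (auto simp: mult_le_0_iff mult_less_0_iff)
        then have "real_of_int (B $ i3 $ 1 * z1 + B $ i3 $ 2 * z2) < 0"
          unfolding val m_signs by auto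
        then show "B $ i3 $ 1 * z1 + B $ i3 $ 2 * z2 < 0" by linarith
        fix j n assume j: "on_line t $ j = of_nat n"
        \<comment> \<open>The value at \<open>j\<close> is \<open>n - l\<close> plus the
          contribution of the offsets; being an integer, it is at most \<open>n\<close> once that
          contribution is below \<open>l + 1\<close>. The values \<open>l\<close> taken from
          \<open>v\<close> are one less than the bounds on the half-open square.\<close>
        have key: "B $ j $ 1 * z1 + B $ j $ 2 * z2 \<le> int n"
          if "v $ j = of_int l" "B $ j $ 1 * s1 + B $ j $ 2 * s2 < l + 1" for l
          using coord[OF j that(1)] that(2) val[of j] by linarith
        consider "j = i1" | "j = i2" | "j = i3" | "j = i4" using outside[OF j] by blast
        then show "B $ j $ 1 * z1 + B $ j $ 2 * z2 \<le> int n"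
        proof cases
          case 1
          have "B $ i1 $ 1 * s1 < real_of_int (B $ i1 $ 1)" "B $ i1 $ 2 * s2 < real_of_int (B $ i1 $ 2)"
            using row1 s by simp_all
          then show ?thesis using key[of "B $ i1 $ 1 + B $ i1 $ 2 - 1"] v_nth(1) 1 by simp
        next
          case 2
          have "B $ i2 $ 1 * s1 \<le> 0" "B $ i2 $ 2 * s2 < real_of_int (B $ i2 $ 2)"
            using row2 s by (simp_all add: mult_le_0_iff)
          then show ?thesis using key[of "B $ i2 $ 2 - 1"] v_nth(2) 2 by simp
        next
          case 3
          then show ?thesis
            using \<open>B $ i3 $ 1 * z1 + B $ i3 $ 2 * z2 < 0\<close> by simp
        next
          case 4
          have "B $ i4 $ 1 * s1 < real_of_int (B $ i4 $ 1)" "B $ i4 $ 2 * s2 \<le> 0"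
            using row4 s by (simp_all add: mult_le_0_iff)
          then show ?thesis using key[of "B $ i4 $ 1 - 1"] v_nth(4) 4 by simp
        qed
      qed
    next
      case True
      \<comment> \<open>Here the real point is itself a lattice point, so \<open>z1\<close>,
        \<open>z2\<close> give zero at \<open>i3\<close> and one further unit step is needed. It
        goes in the direction whose obstructing coordinate is negative.\<close>
      then have z: "real_of_int z1 = r * B $ i3 $ 2" "real_of_int z2 = - r * B $ i3 $ 1"
        by (auto simp: s1_def s2_def)
      have n: "int n = l + (B $ j $ 1 * z1 + B $ j $ 2 * z2)"
        if "on_line t $ j = of_nat n" "v $ j = of_int l" for j n l
        using coord[OF that] val[of j] True by (simp del: of_int_add of_int_mult)
      have z3: "B $ i3 $ 1 * z1 + B $ i3 $ 2 * z2 = 0"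
        using val[of i3] True m_signs by (simp del: of_int_add of_int_mult)
      have "r \<noteq> 0" using t r by simp
      then consider "r > 0" | "r < 0" by linarith
      then show ?thesis
      proof cases
        case 1
        then have "real_of_int z1 < 0" "real_of_int z2 > 0"
          unfolding z using row3 by (simp_all add: mult_less_0_iff)
        then have zs: "z1 \<le> -1" "z2 \<ge> 1" by linarith+
        have "B $ i4 $ 1 * z1 \<le> B $ i4 $ 1 * (-1)" "B $ i4 $ 2 * z2 \<le> B $ i4 $ 2 * 1"
          using zs row4 by (intro mult_left_mono mult_left_mono_neg; simp)+
        note bounds = this
        \<comment> \<open>This coordinate is at most \<open>B $ i4 $ 2 - 1 < 0\<close>. It alone
          would forbid a step in the first direction, because \<open>v $ i4\<close> is one short of
          \<open>B $ i4 $ 1\<close>.\<close>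
        have no4: "on_line t $ i4 \<noteq> of_nat n" for n
        proof
          assume "on_line t $ i4 = of_nat n"
          from n[OF this v_nth(4)] bounds row4 show False by linarith
        qed
        show ?thesis
        proof (rule descendsI[of "z1 + 1" z2])
          show "B $ i3 $ 1 * (z1 + 1) + B $ i3 $ 2 * z2 < 0"
            using z3 row3 by (simp add: algebra_simps)
          fix j k assume j: "on_line t $ j = of_nat k"
          then consider "j = i1" | "j = i2" | "j = i3" using outside[OF j] no4 by blast
          then show "B $ j $ 1 * (z1 + 1) + B $ j $ 2 * z2 \<le> int k"
          proof cases
            case 1
            then show ?thesis using n[of i1 k, OF _ v_nth(1)] j row1 by (simp add: algebra_simps)
          next
            case 2
            then show ?thesis using n[of i2 k, OF _ v_nth(2)] j row2 by (simp add: algebra_simps)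
          next
            case 3
            then show ?thesis using z3 row3 by (simp add: algebra_simps)
          qed
        qed
      next
        case 2
        then have "real_of_int z1 > 0" "real_of_int z2 < 0"
          unfolding z using row3 by (simp_all add: mult_less_0_iff zero_less_mult_iff)
        then have zs: "z1 \<ge> 1" "z2 \<le> -1" by linarith+
        have "B $ i2 $ 1 * z1 \<le> B $ i2 $ 1 * 1" "B $ i2 $ 2 * z2 \<le> B $ i2 $ 2 * (-1)"
          using zs row2 by (intro mult_left_mono mult_left_mono_neg; simp)+
        note bounds = this
        \<comment> \<open>Symmetrically, the coordinate \<open>i2\<close>, which alone would forbid
          a step in the second direction, is at most \<open>B $ i2 $ 1 - 1 < 0\<close>.\<close>
        have no2: "on_line t $ i2 \<noteq> of_nat n" for n
        proof
          assume "on_line t $ i2 = of_nat n"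
          from n[OF this v_nth(2)] bounds row2 show False by linarith
        qed
        show ?thesis
        proof (rule descendsI[of z1 "z2 + 1"])
          show "B $ i3 $ 1 * z1 + B $ i3 $ 2 * (z2 + 1) < 0"
            using z3 row3 by (simp add: algebra_simps)
          fix j k assume j: "on_line t $ j = of_nat k"
          then consider "j = i1" | "j = i4" | "j = i3" using outside[OF j] no2 by blast
          then show "B $ j $ 1 * z1 + B $ j $ 2 * (z2 + 1) \<le> int k"
          proof cases
            case 1
            then show ?thesis using n[of i1 k, OF _ v_nth(1)] j row1 by (simp add: algebra_simps)
          next
            case 2
            then show ?thesis using n[of i4 k, OF _ v_nth(4)] j row4 by (simp add: algebra_simps)
          next
            case 3
            then show ?thesis using z3 row3 by (simp add: algebra_simps)
          qed
        qed
      qed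
    qed
  qed
qed

text \<open>Both entries of row \<open>i3\<close> are negative, so the components of
  \<open>z\<close> have opposite signs; the sign pattern of rows \<open>i2\<close> and
  \<open>i4\<close> then pushes one of these coordinates past that of \<open>v\<close>.\<close>

lemma kernel_on_level:
  assumes "z \<noteq> 0" "(B *v z) $ i3 = 0"
  shows "(B *v z) $ i2 \<ge> B $ i2 $ 2 \<or> (B *v z) $ i4 \<ge> B $ i4 $ 1"
proof -
  have e: "B $ i3 $ 1 * z $ 1 + B $ i3 $ 2 * z $ 2 = 0" using assms(2) by (simp add: Bz)
  consider "z $ 1 \<le> -1" | "z $ 1 = 0" | "z $ 1 \<ge> 1" by linarith
  then show ?thesis
  proof cases
    case 1
    then have "B $ i3 $ 1 * z $ 1 > 0" using row3 by (simp add: mult_neg_neg)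
    then have "z $ 2 > 0" using e row3 by (smt (verit) mult_nonpos_nonpos)
    then have "B $ i2 $ 2 * 1 \<le> B $ i2 $ 2 * z $ 2" "0 \<le> B $ i2 $ 1 * z $ 1"
      using row2 1 by (auto intro: mult_left_mono mult_nonpos_nonpos)
    then show ?thesis by (simp add: Bz)
  next
    case 2
    then have "z $ 2 = 0" using e row3 by simp
    then show ?thesis using 2 assms(1) by (simp add: vec_eq_iff forall_2)
  next
    case 3
    then have "B $ i3 $ 1 * z $ 1 < 0" using row3 by (simp add: mult_neg_pos)
    then have "z $ 2 < 0" using e row3 by (smt (verit) mult_nonpos_nonneg)
    then have "B $ i4 $ 1 * 1 \<le> B $ i4 $ 1 * z $ 1" "0 \<le> B $ i4 $ 2 * z $ 2"
      using row4 3 by (auto intro: mult_left_mono mult_nonpos_nonpos)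
    then show ?thesis by (simp add: Bz)
  qed
qed

section \<open>The kernel of \<open>A\<close> over the integers, the reals and the complex
  numbers\<close>

lemma AB: "A *v (B *v z) = 0"
  using basis_B by (auto simp: bij_betw_def)

lemma kernel_A: "A *v y = 0 \<Longrightarrow> \<exists>z. y = B *v z"
  using basis_B by (auto simp: bij_betw_def)

text \<open>The orthogonal complement \<open>N\<close> of the row space contains the kernel and has
  dimension 2 by the rank condition; the two columns of \<open>B\<close> are independent vectors in
  it.\<close>

lemma real_kernel_A:
  assumes "real_mat A *v x = 0"
  shows "\<exists>(s::real) (t::real). \<forall>j. x $ j = s * B $ j $ 1 + t * B $ j $ 2"
proof -
  define c where "c k = (\<chi> j. real_of_int (B $ j $ k))" for k
  have ker: "real_mat A *v c k = 0" for k
  proof -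
    have "(B *v axis k 1) $ j = B $ j $ k" for j
      by (simp add: matrix_vector_mult_def axis_def if_distrib[of "\<lambda>z. _ * z"] cong: if_cong)
    then have "(real_mat A *v c k) $ i = real_of_int ((A *v (B *v axis k 1)) $ i)" for i
      by (simp add: matrix_vector_mult_def[of A])
        (simp add: matrix_vector_mult_def real_mat_def map_matrix_def c_def)
    then show ?thesis by (simp add: AB vec_eq_iff)
  qed
  define N where "N = {y \<in> UNIV. \<forall>x \<in> span (rows (real_mat A)). orthogonal x y}"
  have null: "y \<in> N" if "real_mat A *v y = 0" for y
    using orthogonal_nullspace_rowspace[OF that] by (auto simp: N_def orthogonal_commute)
  have "dim N + dim (span (rows (real_mat A))) = dim (UNIV :: (real ^ 'n) set)"
    unfolding N_def by (rule dim_subspace_orthogonal_to_vectors) (auto simp: subspace_span)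
  then have dimN: "dim N = 2"
    using rank_A codim by (simp add: row_rank_def)
  \<comment> \<open>A factor of proportionality would be positive by row \<open>i1\<close> and
    negative by row \<open>i2\<close>.\<close>
  have c1: "c 1 \<notin> span {c 2}"
  proof
    assume "c 1 \<in> span {c 2}"
    then obtain k where k: "c 1 = k *\<^sub>R c 2" by (auto simp: span_singleton)
    then have "real_of_int (B $ i1 $ 1) = k * B $ i1 $ 2" "real_of_int (B $ i2 $ 1) = k * B $ i2 $ 2"
      by (simp_all add: c_def vec_eq_iff)
    then have "k * B $ i1 $ 2 > 0" "k * B $ i2 $ 2 < 0" using row1 row2 by (metis of_int_0_less_iff, metis of_int_less_0_iff)
    then show False using row1 row2 by (auto simp: zero_less_mult_iff mult_less_0_iff)
  qed
  moreover have "c 2 \<noteq> 0"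
  proof
    assume "c 2 = 0"
    then have "c 2 $ i1 = 0" by simp
    then show False using row1 by (simp add: c_def)
  qed
  ultimately have ind: "independent {c 1, c 2}"
    by (simp add: independent_insert)
  have "c 1 \<noteq> c 2" using c1 span_base by blast
  then have "N \<subseteq> span {c 1, c 2}"
    using card_ge_dim_independent[of "{c 1, c 2}" N] ind null[OF ker] dimN by simp
  then have "x \<in> span {c 1, c 2}" using null[OF assms] by blast
  then obtain s where "x - s *\<^sub>R c 1 \<in> span {c 2}"
    using span_breakdown_eq by blast
  then obtain t where "x - s *\<^sub>R c 1 = t *\<^sub>R c 2" by (auto simp: span_singleton)
  then have "x $ j = s * B $ j $ 1 + t * B $ j $ 2" for j
    by (simp add: c_def vec_eq_iff algebra_simps)
  then show ?thesis by blast
qed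

text \<open>Real and imaginary parts lie in the real kernel, so \<open>y\<close> is a complex
  combination of the columns of \<open>B\<close>; vanishing at \<open>i3\<close> fixes the ratio of
  the two coefficients.\<close>

lemma complex_kernel_A_level:
  assumes y: "complex_mat A *v y = 0" "y $ i3 = 0"
  shows "\<exists>t. \<forall>j. y $ j = t * of_int (m j)"
proof -
  have sum: "(\<Sum>j\<in>UNIV. of_int (A $ i $ j) * y $ j) = 0" for i
    using y(1) by (simp add: vec_eq_iff matrix_vector_mult_def complex_mat_def map_matrix_def)
  have "(\<Sum>j\<in>UNIV. real_of_int (A $ i $ j) * Re (y $ j)) = 0"
    "(\<Sum>j\<in>UNIV. real_of_int (A $ i $ j) * Im (y $ j)) = 0" for i
    using arg_cong[OF sum[of i], of Re] arg_cong[OF sum[of i], of Im] by simp_all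
  then have R: "real_mat A *v (\<chi> j. Re (y $ j)) = 0" and I: "real_mat A *v (\<chi> j. Im (y $ j)) = 0"
    by (simp_all add: vec_eq_iff matrix_vector_mult_def real_mat_def map_matrix_def)
  obtain s t :: real where st: "\<And>j. Re (y $ j) = s * B $ j $ 1 + t * B $ j $ 2"
    using real_kernel_A[OF R] by auto
  obtain s' t' :: real where st': "\<And>j. Im (y $ j) = s' * B $ j $ 1 + t' * B $ j $ 2"
    using real_kernel_A[OF I] by auto
  have yj: "y $ j = Complex s s' * of_int (B $ j $ 1) + Complex t t' * of_int (B $ j $ 2)" for j
    by (simp add: complex_eq_iff st st')
  have b: "of_int (B $ i3 $ 2) \<noteq> (0::complex)" using row3 by simp
  have T: "Complex t t' = - (Complex s s' / of_int (B $ i3 $ 2)) * of_int (B $ i3 $ 1)"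
    using y(2) b unfolding yj by (simp add: field_simps add_eq_0_iff)
  have "y $ j = (Complex s s' / of_int (B $ i3 $ 2)) * of_int (m j)" for j
    unfolding yj T m_def using b by (simp add: field_simps)
  then show ?thesis by blast
qed

lemma fibre_A:
  assumes "A *v ivec a = A *v ivec b"
  shows "\<exists>z. ivec a - ivec b = B *v z"
  by (rule kernel_A) (simp add: matrix_vector_mult_diff_distrib assms)

section \<open>The exponent \<open>v\<close> as a fake exponent\<close>

lemma v_natural: "j \<in> {i1, i2, i3, i4} \<Longrightarrow> \<exists>n. v $ j = of_nat n"
proof -
  have nat: "\<exists>n. of_int k = (of_nat n :: complex)" if "k \<ge> 0" for k
    using that by (metis nat_0_le of_int_of_nat_eq)
  assume "j \<in> {i1, i2, i3, i4}"
  moreover have "\<exists>n. (0::complex) = of_nat n" by (intro exI[of _ 0]) simp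
  ultimately show ?thesis using v_nth(1-4) row1 row2 row4
    by (elim insertE emptyE) (simp_all only: v_nth(1-4), (rule nat, linarith)+)
qed

lemma v_not_integer: "j \<notin> {i1, i2, i3, i4} \<Longrightarrow> v $ j \<noteq> of_int k"
  using v_nth(5)[of j] \<alpha>_irrational[of j]
  by (metis Rats_diff Rats_of_int add_diff_cancel_left')

lemma on_line_0: "on_line 0 = v"
  by (simp add: on_line_def vec_eq_iff)

text \<open>This makes a falling factorial vanish in the derivative of order \<open>u\<close> of the
  monomial with exponent \<open>v\<close>. A negative value at \<open>i3\<close> uses that
  \<open>v\<close> does not descend, zero uses \<open>kernel_on_level\<close>, and a positive value
  uses \<open>v $ i3 = 0\<close>.\<close>

lemma not_descends_vanishing:
  assumes v: "\<not> descends v" and z: "z \<noteq> 0" and u: "\<And>j. (B *v z) $ j \<le> int (u $ j)"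
  shows "\<exists>j n. v $ j = of_nat n \<and> n < u $ j"
proof -
  consider "(B *v z) $ i3 < 0" | "(B *v z) $ i3 = 0" | "(B *v z) $ i3 > 0" by linarith
  then show ?thesis
  proof cases
    case 1
    then obtain j n where "v $ j = of_nat n" "\<not> (B *v z) $ j \<le> int n"
      using v unfolding descends_def by blast
    then show ?thesis using u[of j] by (intro exI[of _ j] exI[of _ n]) auto
  next
    case 2
    from kernel_on_level[OF z this] show ?thesis
    proof
      assume "(B *v z) $ i2 \<ge> B $ i2 $ 2"
      then have "v $ i2 = of_nat (nat (B $ i2 $ 2 - 1))" "nat (B $ i2 $ 2 - 1) < u $ i2"
        using u[of i2] row2 v_nth(2) by auto
      then show ?thesis by blast
    next
      assume "(B *v z) $ i4 \<ge> B $ i4 $ 1"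
      then have "v $ i4 = of_nat (nat (B $ i4 $ 1 - 1))" "nat (B $ i4 $ 1 - 1) < u $ i4"
        using u[of i4] row4 v_nth(4) by auto
      then show ?thesis by blast
    qed
  next
    case 3
    then show ?thesis using u[of i3] v_nth(3) by (intro exI[of _ i3] exI[of _ 0]) auto
  qed
qed

text \<open>Both exponents have the same image under \<open>A\<close> and agree at
  \<open>i3\<close>, so \<open>u\<close> is \<open>on_line t\<close>. A witness of
  \<open>descends u\<close> would contradict \<open>standard_pair_no_decrease\<close>, and this
  excludes \<open>t \<noteq> 0\<close>.\<close>

lemma fake_exponent_imp:
  assumes w: "admissible_weight A i3 w'" and u: "fake_exponent A (complex_mat A *v v) w' u" "u $ i3 = 0"
  shows "u = v \<and> \<not> descends v"
proof -
  have "complex_mat A *v (u - v) = 0"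
    using u(1) by (simp add: fake_exponent_def matrix_vector_mult_diff_distrib)
  moreover have "(u - v) $ i3 = 0" using u(2) v_nth(3) by simp
  ultimately obtain t where t: "\<And>j. (u - v) $ j = t * of_int (m j)"
    using complex_kernel_A_level by blast
  have ut: "u = on_line t"
  proof (unfold vec_eq_iff, rule allI)
    fix j show "u $ j = on_line t $ j" using t[of j] by (simp add: on_line_def algebra_simps)
  qed
  obtain \<eta> \<sigma> where sp: "standard_pair (initial_ideal w' (toric_ideal A)) \<eta> \<sigma>"
    and \<eta>: "\<And>i. i \<notin> \<sigma> \<Longrightarrow> u $ i = of_nat (\<eta> $ i)"
    using u(1) by (auto simp: fake_exponent_def)
  have "\<not> descends u"
  proof
    assume "descends u"
    then obtain z where z: "(B *v z) $ i3 < 0" "\<And>j n. u $ j = of_nat n \<Longrightarrow> (B *v z) $ j \<le> int n"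
      by (auto simp: descends_def)
    obtain j where "j \<notin> \<sigma>" "int (\<eta> $ j) < (B *v z) $ j"
      using standard_pair_no_decrease[OF w sp AB z(1)] by blast
    then show False using z(2)[OF \<eta>] by force
  qed
  then have "t = 0" using descends_on_line ut by blast
  then show ?thesis using \<open>\<not> descends u\<close> ut on_line_0 by simp
qed

text \<open>All monomials that agree with \<open>v\<close> in the first four coordinates, the others
  being free, are outside the initial ideal; a maximal enlargement of the free set gives a standard
  pair for \<open>v\<close>.\<close>

lemma fake_exponent_v:
  assumes w: "admissible_weight A i3 w'" and v: "\<not> descends v"
  shows "fake_exponent A (complex_mat A *v v) w' v"
proof -
  let ?M = "initial_ideal w' (toric_ideal A)" and ?S = "{i1, i2, i3, i4}"
  have "\<forall>j\<in>?S. \<exists>n. v $ j = of_nat n" using v_natural by blast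
  then obtain h where h: "\<And>j. j \<in> ?S \<Longrightarrow> v $ j = of_nat (h j)" by metis
  have "\<exists>\<eta>' \<sigma>. standard_pair ?M \<eta>' \<sigma> \<and> - ?S \<subseteq> \<sigma> \<and> (\<forall>i. i \<notin> \<sigma> \<longrightarrow> \<eta>' $ i = (\<chi> j. h j) $ i)"
  proof (rule standard_pair_exists)
    show "r * s \<in> ?M" if "s \<in> ?M" for r s
      using that unfolding initial_ideal_def by (rule ideal_gen_mult)
    fix \<mu> :: "nat ^ 'n" assume "\<forall>i. i \<notin> - ?S \<longrightarrow> \<mu> $ i = (\<chi> j. h j) $ i"
    then have \<mu>: "\<And>i. i \<in> ?S \<Longrightarrow> v $ i = of_nat (\<mu> $ i)" using h by auto
    have "\<mu> \<in> unique_top A i3"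
      unfolding unique_top_def
    proof (intro CollectI allI impI)
      fix b assume b: "A *v ivec b = A *v ivec \<mu>" "\<mu> $ i3 \<le> b $ i3"
      obtain z where z: "ivec \<mu> - ivec b = B *v z" using fibre_A b(1) by metis
      have Bz: "(B *v z) $ j = int (\<mu> $ j) - int (b $ j)" for j
        unfolding z[symmetric] by simp
      have "z = 0"
      proof (rule ccontr)
        assume "z \<noteq> 0"
        moreover have "(B *v z) $ j \<le> int (\<mu> $ j)" for j unfolding Bz by simp
        \<comment> \<open>Such a \<open>j\<close> is among the first four indices, since the other
          coordinates of \<open>v\<close> are not integers; but there \<open>\<mu>\<close> coincides
          with \<open>v\<close>.\<close>
        ultimately obtain j n where j: "v $ j = of_nat n" "n < \<mu> $ j"
          using not_descends_vanishing[OF v] by blast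
        then have "j \<in> ?S" using v_not_integer[of j "int n"] by force
        then show False using \<mu>[of j] j by simp
      qed
      then have "ivec \<mu> - ivec b = 0" using z by simp
      then show "b = \<mu>" by (simp add: vec_eq_iff)
    qed
    then show "dmonom \<mu> \<notin> ?M" by (rule unique_top_notin_initial_ideal[OF w])
  qed
  then obtain \<eta>' \<sigma> where "standard_pair ?M \<eta>' \<sigma>" "- ?S \<subseteq> \<sigma>" "\<And>i. i \<notin> \<sigma> \<Longrightarrow> \<eta>' $ i = h i"
    by auto
  then show ?thesis using h unfolding fake_exponent_def
    by (intro conjI exI[of _ \<eta>'] exI[of _ \<sigma>]) auto
qed

text \<open>Four coordinates of \<open>v\<close> are natural and the others are not integers, so the
  negative support is empty and hence minimal.\<close>

lemma min_neg_support_v: "min_neg_support A v"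
proof -
  have "nsupp v = {}"
  proof (rule ccontr)
    assume "nsupp v \<noteq> {}"
    then obtain j k where k: "k < 0" "v $ j = of_int k" by (auto simp: nsupp_def)
    then have "j \<in> {i1, i2, i3, i4}" using v_not_integer by blast
    then obtain n where "v $ j = of_nat n" using v_natural by blast
    then have "k = int n" using k by (metis of_int_eq_iff of_int_of_nat_eq)
    then show False using k by simp
  qed
  then show ?thesis by (simp add: min_neg_support_def)
qed

end

section \<open>The kernel of the derivation\<close>

lemma cpartial_zero: "cpartial i (\<lambda>_. 0) = (\<lambda>_. 0)"
  by (rule ext) (rule has_cgradient_cpartial(2)[OF has_cgradient_const])

lemma multi_cpartial_zero_fun: "multi_cpartial b (\<lambda>_. 0) x = 0"
proof -
  have "foldr cpartial is (\<lambda>_. 0) = (\<lambda>_. 0)" for "is" :: "'a list"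
    by (induction "is") (auto simp: cpartial_zero)
  then show ?thesis by (simp add: multi_cpartial_def)
qed

lemma zero_in_solutions: "0 \<in> solutions U H"
proof -
  have "weyl_apply P (0 :: complex ^ 'a \<Rightarrow> complex) x = 0" for P x
    by (simp add: weyl_apply_def zero_fun_def multi_cpartial_zero_fun case_prod_unfold)
  moreover have "holomorphic_sev_on (0 :: complex ^ 'a \<Rightarrow> complex) U"
    unfolding zero_fun_def by (rule holomorphic_sev_onI) (rule has_cgradient_const)
  ultimately show ?thesis by (simp add: solutions_def)
qed

lemma multi_cpartial_cmult:
  assumes f: "holomorphic_sev_on f U" and U: "open U" and x: "x \<in> U"
  shows "multi_cpartial b (\<lambda>y. c * f y) x = c * multi_cpartial b f x"
proof -
  have g: "has_cgradient (\<lambda>y. c * g y) (\<lambda>j. c * cpartial j g x) x"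
    if "holomorphic_sev_on g U" "x \<in> U" for g x
    by (rule has_cgradient_cmult[OF holomorphic_sev_on_cgradient[OF that]])
  have hol: "holomorphic_sev_on (\<lambda>y. c * f y) U" by (rule holomorphic_sev_onI[OF g[OF f]])
  have "foldr cpartial is (\<lambda>y. c * f y) x = c * foldr cpartial is f x" if "x \<in> U" for "is" x
    using that
  proof (induction "is" arbitrary: x)
    case (Cons i "is")
    have "cpartial i (foldr cpartial is (\<lambda>y. c * f y)) x = cpartial i (\<lambda>y. c * foldr cpartial is f y) x"
      by (rule cpartial_cong[OF U Cons.prems Cons.IH holomorphic_sev_on_foldr_cpartial[OF hol U]])
    also have "\<dots> = c * cpartial i (foldr cpartial is f) x"
      by (rule has_cgradient_cpartial(2)[OF g[OF holomorphic_sev_on_foldr_cpartial[OF f U] Cons.prems]])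
    finally show ?case by simp
  qed simp
  then show ?thesis using x by (simp add: multi_cpartial_def)
qed

lemma fun_scale_in_solutions:
  assumes U: "open U" and f: "f \<in> solutions U H"
  shows "fun_scale c f \<in> solutions U H"
proof -
  have hol: "holomorphic_sev_on f U" using f by (simp add: solutions_def)
  have "weyl_apply P (fun_scale c f) x = c * weyl_apply P f x" if "x \<in> U" for P x
    unfolding weyl_apply_def fun_scale_def multi_cpartial_cmult[OF hol U that] sum_distrib_left
    by (intro sum.cong) (auto simp: case_prod_unfold)
  moreover have "holomorphic_sev_on (fun_scale c f) U"
    unfolding fun_scale_def
    by (rule holomorphic_sev_onI[OF has_cgradient_cmult[OF holomorphic_sev_on_cgradient[OF hol]]])
  ultimately show ?thesis using f by (auto simp: solutions_def fun_scale_def)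
qed

context gale
begin

text \<open>For distinct exponents in one fibre both derivatives of the monomial vanish separately,
  since \<open>not_descends_vanishing\<close> applies to \<open>z\<close> and to \<open>- z\<close>.
  The derivative at \<open>i3\<close> vanishes because \<open>v $ i3 = 0\<close>.\<close>

lemma cmonomial_on_in_kernel:
  assumes v: "\<not> descends v" and U: "open U" and L: "log_branches U L"
  shows "cmonomial_on U L v \<in> solutions U (hypergeometric_ideal A (complex_mat A *v v))"
    and "cpartial_on U i3 (cmonomial_on U L v) = 0"
proof -
  let ?f = "cmonomial_on U L v"
  note U0 = log_branches_nonzero[OF L]
  have hol: "holomorphic_sev_on ?f U" by (rule holomorphic_sev_on_cmonomial_on[OF L U])
  have cp: "cpartial j ?f x = v $ j * cmonomial_on U L (v - axis j 1) x" if "x \<in> U" for j x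
    by (rule has_cgradient_cpartial(2)[OF has_cgradient_cmonomial_on[OF L U that]])
  show "cpartial_on U i3 ?f = 0"
    using cp v_nth(3) by (simp add: cpartial_on_def fun_eq_iff)
  have "euler_solution U A (complex_mat A *v v) ?f"
    unfolding euler_solution_def
  proof (intro allI ballI)
    fix i x assume x: "x \<in> U"
    have "x $ j * cpartial j ?f x = v $ j * ?f x" for j
      using U0[OF x, of j] by (simp add: cp[OF x] cmonomial_on_diff_axis[OF L x])
    then show "(\<Sum>j\<in>UNIV. of_int (A $ i $ j) * (x $ j * cpartial j ?f x)) = (complex_mat A *v v) $ i * ?f x"
      by (simp add: matrix_vector_mult_def complex_mat_def map_matrix_def sum_distrib_right mult.assoc)
  qed
  moreover have "toric_solution U A ?f"
    unfolding toric_solution_def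
  proof (intro allI impI ballI)
    fix u u' x assume u: "A *v ivec u = A *v ivec u'" and x: "x \<in> U"
    have van: "multi_cpartial u ?f x = 0" if z: "z \<noteq> 0" "\<And>j. (B *v z) $ j \<le> int (u $ j)" for z u
    proof -
      obtain j n where "v $ j = of_nat n" "n < u $ j" using not_descends_vanishing[OF v z] by blast
      then have "(\<Prod>k<u $ j. v $ j - of_nat k) = 0" by (intro prod_zero) auto
      then have "(\<Prod>i\<in>UNIV. \<Prod>k<u $ i. v $ i - of_nat k) = 0" by (intro prod_zero) auto
      then show ?thesis by (simp add: multi_cpartial_cmonomial_on[OF L U x])
    qed
    obtain z where z: "ivec u - ivec u' = B *v z" using fibre_A[OF u] by blast
    have Bz: "(B *v z) $ j = int (u $ j) - int (u' $ j)" for j unfolding z[symmetric] by simp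
    show "multi_cpartial u ?f x = multi_cpartial u' ?f x"
    proof (cases "z = 0")
      case True
      then have "ivec u - ivec u' = 0" using z by simp
      then have "u = u'" by (simp add: vec_eq_iff)
      then show ?thesis by simp
    next
      case False
      have "multi_cpartial u ?f x = 0" by (rule van[OF False]) (simp add: Bz)
      moreover have "B *v (- z) = - (B *v z)"
        using matrix_vector_mult_diff_distrib[of B 0 z] by simp
      then have "multi_cpartial u' ?f x = 0"
        using False by (intro van[of "- z"]) (simp_all add: Bz)
      ultimately show ?thesis by simp
    qed
  qed
  moreover have "\<forall>x. x \<notin> U \<longrightarrow> ?f x = 0" by (simp add: cmonomial_on_def)
  ultimately show "?f \<in> solutions U (hypergeometric_ideal A (complex_mat A *v v))"
    using hol solutions_iff[OF U, of ?f A "complex_mat A *v v"] U0 by blast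
qed

text \<open>No nonzero parameter is a common root of \<open>ann\<close>. The parameter 0 is excluded
  too if \<open>v\<close> descends, and it is at most a simple root in any case, which leaves only
  multiples of the monomial.\<close>

lemma kernel_cases:
  assumes Uo: "open U" "connected U" "U \<noteq> {}" and L: "log_branches U L"
    and sol: "\<psi> \<in> solutions U (hypergeometric_ideal A (complex_mat A *v v))"
    and ker: "cpartial_on U i3 \<psi> = 0"
  shows "descends v \<Longrightarrow> \<psi> = 0" "\<not> descends v \<Longrightarrow> \<exists>c. \<psi> = fun_scale c (cmonomial_on U L v)"
proof -
  note U0 = log_branches_nonzero[OF L]
  have hol: "holomorphic_sev_on \<psi> U" and z: "\<And>x. x \<notin> U \<Longrightarrow> \<psi> x = 0"
    and t: "toric_solution U A \<psi>" and e: "euler_solution U A (complex_mat A *v v) \<psi>"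
    using sol solutions_iff[OF Uo(1), of \<psi> A "complex_mat A *v v"] U0 by blast+
  have d3: "cpartial i3 \<psi> x = 0" if "x \<in> U" for x
    using fun_cong[OF ker, of x] that by (simp add: cpartial_on_def)
  have m2: "complex_of_int (m i2) \<noteq> 0" using m_signs by simp
  \<comment> \<open>\<open>E\<close> is normalised so that the equation \<open>line\<close> holds at
    \<open>i2\<close>, where \<open>m\<close> does not vanish; the other coordinates follow from the
    Euler equations.\<close>
  define E where "E g x = 1 / of_int (m i2) * log_partial i2 g x + (- v $ i2 / of_int (m i2)) * g x"
    for g :: "complex ^ 'n \<Rightarrow> complex" and x
  interpret log_line U \<psi> v "\<lambda>j. of_int (m j)" E "1 / of_int (m i2)" "- v $ i2 / of_int (m i2)" i2
  proof
    show "open U" "holomorphic_sev_on \<psi> U" by fact+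
    show "E g x = 1 / of_int (m i2) * log_partial i2 g x + (- v $ i2 / of_int (m i2)) * g x" for g x
      by (simp add: E_def)
    fix x j assume x: "x \<in> U"
    \<comment> \<open>The deviation from homogeneity with exponent \<open>v\<close>: the Euler
      equations put it in the kernel of \<open>A\<close>, and it vanishes at \<open>i3\<close>
      because the derivative of \<open>\<psi>\<close> there is zero. So it is a multiple of
      \<open>m\<close>.\<close>
    define y where "y = (\<chi> j. log_partial j \<psi> x - v $ j * \<psi> x)"
    have "(complex_mat A *v y) $ i = 0" for i
    proof -
      have "(complex_mat A *v y) $ i =
          (\<Sum>j\<in>UNIV. of_int (A $ i $ j) * (x $ j * cpartial j \<psi> x)) - (complex_mat A *v v) $ i * \<psi> x"
        by (simp add: matrix_vector_mult_def complex_mat_def map_matrix_def y_def log_partial_def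
            right_diff_distrib sum_subtractf sum_distrib_right mult.assoc)
      then show ?thesis using e x by (simp add: euler_solution_def)
    qed
    then have "complex_mat A *v y = 0" by (simp add: vec_eq_iff)
    moreover have "y $ i3 = 0" using d3[OF x] v_nth(3) by (simp add: y_def log_partial_def)
    ultimately obtain s where s: "\<And>j. y $ j = s * of_int (m j)" using complex_kernel_A_level by blast
    have "s = E \<psi> x"
      using s[of i2] m2 by (simp add: y_def E_def field_simps)
    then show "log_partial j \<psi> x = v $ j * \<psi> x + of_int (m j) * E \<psi> x"
      using s[of j] by (simp add: y_def algebra_simps)
  qed
  define pp where "pp z = (\<chi> j. nat ((B *v z) $ j))" for z
  have pp_ann: "indicial (pp z) \<in> ann" if z: "(B *v z) $ i3 < 0" for z
  proof (rule indicial_in_ann[OF U0])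
    fix x assume x: "x \<in> U"
    define u' where "u' = (\<chi> j. nat (- (B *v z) $ j))"
    have "ivec (pp z) - ivec u' = B *v z" by (simp add: vec_eq_iff pp_def u'_def)
    then have "A *v (ivec (pp z) - ivec u') = 0" using AB by simp
    then have "A *v ivec (pp z) = A *v ivec u'" by (simp add: matrix_vector_mult_diff_distrib)
    then have "multi_cpartial (pp z) \<psi> x = multi_cpartial u' \<psi> x"
      using t x unfolding toric_solution_def by blast
    \<comment> \<open>The negative part of \<open>B *v z\<close> is nonzero at \<open>i3\<close>, so
      one derivative in that direction can be taken first, and it kills
      \<open>\<psi>\<close>.\<close>
    also have "u' = (u' - axis i3 1) + axis i3 1"
      using z by (auto simp: vec_eq_iff u'_def axis_def)
    also have "multi_cpartial \<dots> \<psi> x = multi_cpartial (u' - axis i3 1) (cpartial i3 \<psi>) x"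
      by (rule multi_cpartial_add_axis(2)[OF hol Uo(1) x])
    also have "\<dots> = multi_cpartial (u' - axis i3 1) (\<lambda>_. 0) x"
      by (rule multi_cpartial_cong[OF holomorphic_sev_on_cpartial[OF hol Uo(1)] Uo(1) x d3])
    finally show "multi_cpartial (pp z) \<psi> x = 0" by (simp add: multi_cpartial_zero_fun)
  qed
  \<comment> \<open>A factor of the indicial polynomial that vanishes at \<open>s\<close> would be a
    natural coordinate of \<open>on_line s\<close> below the positive part of \<open>B *v z\<close>,
    which descent forbids.\<close>
  have nonroot: "\<exists>p\<in>ann. poly p s \<noteq> 0" if descends: "descends (on_line s)" for s
  proof -
    obtain z where z: "(B *v z) $ i3 < 0"
      "\<And>j n. on_line s $ j = of_nat n \<Longrightarrow> (B *v z) $ j \<le> int n"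
      using descends by (auto simp: descends_def)
    have "v $ j + s * of_int (m j) - of_nat k \<noteq> 0" if "k < pp z $ j" for j k
    proof
      assume "v $ j + s * of_int (m j) - of_nat k = 0"
      then have "on_line s $ j = of_nat k" by (simp add: on_line_def)
      then have "(B *v z) $ j \<le> int k" by (rule z(2))
      then show False using that by (simp add: pp_def)
    qed
    then have "poly (indicial (pp z)) s \<noteq> 0" unfolding poly_indicial by (simp add: prod_zero_iff)
    then show ?thesis using pp_ann[OF z(1)] by blast
  qed
  {
    assume "descends v"
    then have "\<exists>p\<in>ann. poly p s \<noteq> 0" for s
      using nonroot[of s] descends_on_line[of s] on_line_0 by (cases "s = 0") auto
    then have "\<psi> x = 0" for x using zero_if_no_common_root z by blast
    then show "\<psi> = 0" by (simp add: fun_eq_iff)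
  }
  \<comment> \<open>For \<open>z = (1, 0)\<close> the last factor at \<open>i4\<close> has
    \<open>k = l\<close>, which equals \<open>v $ i4\<close>, so it is \<open>m i4\<close> times the
    indeterminate. No other factor vanishes at 0, which makes 0 a simple root.\<close>
  let ?u = "pp (axis 1 1)"
  define F where "F j k = [:v $ j - of_nat k, complex_of_int (m j):]" for j k
  define l where "l = nat (B $ i4 $ 1 - 1)"
  have u: "?u $ j = nat (B $ j $ 1)" for j by (simp add: pp_def Bz axis_def)
  have l: "?u $ i4 = Suc l" "v $ i4 = of_nat l" using row4 v_nth(4) by (simp_all add: u l_def)
  define R where "R = (\<Prod>k<l. F i4 k) * (\<Prod>j\<in>UNIV - {i4}. \<Prod>k<?u $ j. F j k)"
  have "indicial ?u = (\<Prod>k<Suc l. F i4 k) * (\<Prod>j\<in>UNIV - {i4}. \<Prod>k<?u $ j. F j k)"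
    unfolding indicial_def F_def[symmetric] l(1)[symmetric] by (rule prod.remove) auto
  also have "\<dots> = F i4 l * R" unfolding R_def by (simp add: mult_ac)
  also have "\<dots> = pCons 0 (smult (of_int (m i4)) R)" by (simp add: F_def l(2))
  finally have ind: "indicial ?u = pCons 0 (smult (of_int (m i4)) R)" .
  \<comment> \<open>Rows \<open>i2\<close> and \<open>i3\<close> contribute no factors, at
    \<open>i1\<close> the value of \<open>v\<close> is at least \<open>B $ i1 $ 1\<close>, and the
    coordinates outside the first four are not integers.\<close>
  have "v $ j \<noteq> of_nat k" if "k < ?u $ j" "j \<noteq> i4" for j k
  proof
    assume eq: "v $ j = of_nat k"
    have kB: "int k < B $ j $ 1" using that(1) by (simp add: u)
    have "j \<in> {i1, i2, i3, i4}" using v_not_integer[of j "int k"] eq by auto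
    then have "j = i1" using that(2) kB row2 row3 by auto
    then have "of_int (int k) = (of_int (B $ i1 $ 1 + B $ i1 $ 2 - 1) :: complex)"
      using eq v_nth(1) by simp
    then have "int k = B $ i1 $ 1 + B $ i1 $ 2 - 1" by (simp only: of_int_eq_iff)
    then show False using kB row1 \<open>j = i1\<close> by simp
  qed
  then have "poly R 0 \<noteq> 0"
    by (simp add: R_def F_def poly_prod prod_zero_iff l(2))
  then have R0: "poly (smult (of_int (m i4)) R) 0 \<noteq> 0" using m_signs by simp
  have "(B *v axis 1 1) $ i3 < 0" using row3 by (simp add: Bz axis_def)
  from pp_ann[OF this] have R1: "pCons 0 (smult (of_int (m i4)) R) \<in> ann" by (simp add: ind)
  have "log_partial j \<psi> x = v $ j * \<psi> x" if "x \<in> U" for j x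
    by (rule homogeneous_if_simple_common_root[OF nonroot[OF descends_on_line] R1 R0 that])
  then show "\<exists>c. \<psi> = fun_scale c (cmonomial_on U L v)"
    using homogeneous_eq_cmonomial_on[OF L Uo hol z, of v] by (simp add: log_partial_def)
qed

end

theorem theorem4p2:
  fixes A :: "int ^ 'n::finite ^ 'd::finite"
    and B :: "int ^ 2 ^ 'n"
    and r0 :: 'd
    and i1 i2 i3 i4 :: 'n
    and \<alpha> :: "'n \<Rightarrow> complex"
    and v :: "complex ^ 'n"
    and \<beta> :: "complex ^ 'd"
    and w' :: "real ^ 'n"
    and U :: "(complex ^ 'n) set"
    and L :: "'n \<Rightarrow> complex ^ 'n \<Rightarrow> complex"
  assumes codim: "CARD('n) = CARD('d) + 2"
    and rank_A: "rank (real_mat A) = CARD('d)"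
    and first_row: "\<And>j. A $ r0 $ j = 1"
    and span_A: "\<And>y :: int ^ 'd. \<exists>u :: int ^ 'n. A *v u = y"
    and basis_B: "bij_betw (\<lambda>z :: int ^ 2. B *v z) UNIV {u. A *v u = 0}"
    and idx: "distinct [i1, i2, i3, i4]"
    and row1: "B $ i1 $ 1 > 0" "B $ i1 $ 2 > 0"
    and row2: "B $ i2 $ 1 < 0" "B $ i2 $ 2 > 0"
    and row3: "B $ i3 $ 1 < 0" "B $ i3 $ 2 < 0"
    and row4: "B $ i4 $ 1 > 0" "B $ i4 $ 2 < 0"
    and quadrant: "independent {row i2 (real_mat B), row i4 (real_mat B)} \<Longrightarrow>
      {z :: real ^ 2. (real_mat B *v z) $ i2 \<ge> 0 \<and> (real_mat B *v z) $ i4 \<ge> 0}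
        \<subseteq> {z. z $ 1 \<ge> 0 \<and> z $ 2 \<ge> 0}"
    and \<alpha>_irrational: "\<And>i. i \<notin> {i1, i2, i3, i4} \<Longrightarrow> \<alpha> i \<notin> \<rat>"
    and \<alpha>_generic: "\<And>i. i \<notin> {i1, i2, i3, i4} \<Longrightarrow>
      \<alpha> i \<notin> rat_adjoin (\<alpha> ` (UNIV - {i1, i2, i3, i4, i}))"
    and v_def: "v = complex_vec (pos_part (column 1 B) + pos_part (column 2 B))
      - axis i1 1 - axis i2 1 - axis i4 1 + (\<Sum>i \<in> UNIV - {i1, i2, i3, i4}. axis i (\<alpha> i))"
    and \<beta>_def: "\<beta> = complex_mat A *v (v - axis i3 1)"
    and weight: "admissible_weight A i3 w'"
    and U: "open U" "connected U" "U \<noteq> {}"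
    and L: "log_branches U L"
  shows "linear_map_between
           (solutions U (hypergeometric_ideal A (complex_mat A *v v)))
           (solutions U (hypergeometric_ideal A \<beta>))
           (cpartial_on U i3)
       \<and> {\<psi> \<in> solutions U (hypergeometric_ideal A (complex_mat A *v v)). cpartial_on U i3 \<psi> = 0}
         = fun_span {cmonomial_on U L u | u.
             fake_exponent A (complex_mat A *v v) w' u \<and> min_neg_support A u \<and> u $ i3 = 0}"
proof -
  interpret gale A B i1 i2 i3 i4 \<alpha> v
    by unfold_locales (fact assms)+
  interpret fs: module "fun_scale :: complex \<Rightarrow> (complex ^ 'n \<Rightarrow> complex) \<Rightarrow> complex ^ 'n \<Rightarrow> complex"
    by (rule module_fun_scale)
  let ?S = "solutions U (hypergeometric_ideal A (complex_mat A *v v))"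
  let ?K = "{\<psi> \<in> ?S. cpartial_on U i3 \<psi> = 0}"
  have "\<beta> $ i = (complex_mat A *v v) $ i - of_int (A $ i $ i3)" for i
  proof -
    have "(complex_mat A *v axis i3 1) $ i = (\<Sum>j\<in>UNIV. if j = i3 then of_int (A $ i $ j) else 0)"
      unfolding matrix_vector_mult_def complex_mat_def map_matrix_def vec_lambda_beta
      by (rule sum.cong) (auto simp: axis_def)
    then show ?thesis by (simp add: \<beta>_def matrix_vector_mult_diff_distrib)
  qed
  then have lin: "linear_map_between ?S (solutions U (hypergeometric_ideal A \<beta>)) (cpartial_on U i3)"
    using cpartial_on_linear_map_between[OF U(1)] log_branches_nonzero[OF L] by blast
  have scale: "fun_scale c \<psi> \<in> ?K" if "\<psi> \<in> ?K" for c \<psi>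
  proof -
    have "cpartial_on U i3 (fun_scale c \<psi>) = fun_scale c (cpartial_on U i3 \<psi>)"
      using lin that by (simp add: linear_map_between_def)
    then show ?thesis
      using that fun_scale_in_solutions[OF U(1), of \<psi>] by (simp add: fun_scale_def fun_eq_iff)
  qed
  have "?K = fun_span {cmonomial_on U L u | u.
             fake_exponent A (complex_mat A *v v) w' u \<and> min_neg_support A u \<and> u $ i3 = 0}"
  \<comment> \<open>If \<open>v\<close> descends, no exponent qualifies and the kernel is zero, the
    span of the empty set; otherwise \<open>v\<close> is the only one.\<close>
  proof (cases "descends v")
    case True
    then have "{cmonomial_on U L u | u.
        fake_exponent A (complex_mat A *v v) w' u \<and> min_neg_support A u \<and> u $ i3 = 0} = {}"
      using fake_exponent_imp[OF weight] by blast
    moreover have "cpartial_on U i3 0 = 0"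
      unfolding cpartial_on_def zero_fun_def cpartial_zero by simp
    then have "?K = {0}"
      using kernel_cases(1)[OF U L _ _ True] zero_in_solutions by blast
    ultimately show ?thesis by (simp only: fun_span_def fs.span_empty)
  next
    case False
    then have "{cmonomial_on U L u | u.
        fake_exponent A (complex_mat A *v v) w' u \<and> min_neg_support A u \<and> u $ i3 = 0} = {cmonomial_on U L v}"
      using fake_exponent_imp[OF weight] fake_exponent_v[OF weight False] min_neg_support_v v_nth(3)
      by blast
    moreover have "?K = range (\<lambda>c. fun_scale c (cmonomial_on U L v))"
      using kernel_cases(2)[OF U L _ _ False] cmonomial_on_in_kernel[OF False U(1) L] scale by blast
    ultimately show ?thesis by (simp add: fun_span_def fs.span_singleton)
  qed
  with lin show ?thesis by blast
qed

end
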